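(* The Lookup Conjecture is true for $\tilde A_2$: let $W$ be the affine Weyl group of type $\tilde A_2$. For all $w\in W$ and all $x\le w$, the point $x\mathcal B$ is not rationally smooth in the Schubert variety $X_w$ if and only if $q^w_y>0$ either for $y=x$ or for some $y=rx$ with $r$ a reflection in $W$ and $x<rx\le w$.
   Context: $W$ is the affine Weyl group of type $\tilde A_2$, i.e. the Coxeter group with simple reflections $s_0,s_1,s_2$ with $(s_is_j)^3=e$ for $i\ne j$; its length function is $\ell$, its Bruhat order is $\le$, and its reflections are the conjugates of the $s_i$. For $x\le w$, $n^w_x$ is the number of reflections $r\in W$ with $rx\le w$, and $q^w_x=n^w_x-\ell(w)$ (always $\ge0$). $\mathcal G$ is the Kac–Moody group over $\mathbb C$ of affine type $\tilde A_2$ with Weyl group $W$ and standard Borel $\mathcal B$; $X_w=\bigcup_{x\le w}\mathcal Bx\mathcal B/\mathcal B\subset\mathcal G/\mathcal B$ is the Schubert variety, of dimension $\ell(w)$. A point $p$ of an irreducible variety $Y$ of dimension $d$ is rationally smooth if it has a neighborhood $U$ such that for all $y\in U$, $H^i(Y,Y\setminus\{y\};\mathbb Q)$ is $\mathbb Q$ for $i=2d$ and $0$ otherwise. By the Carrell–Peterson criterion, $x\mathcal B$ is not rationally smooth in $X_w$ if and only if $q^w_y>0$ for some $y$ with $x\le y\le w$. *)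

theory Defs
  imports "HOL-Analysis.Analysis" "HOL-Homology.Homology" "HOL-Computational_Algebra.Formal_Laurent_Series"
begin

section \<open>The Coxeter group of type affine A2\<close>

datatype node = N0 | N1 | N2

text \<open>The congruence on words in the free monoid on the three nodes that is generated by the
  Coxeter relations.\<close>

inductive coxeter_eq :: "node list \<Rightarrow> node list \<Rightarrow> bool" where
  refl: "coxeter_eq u u"
| sym: "coxeter_eq u v \<Longrightarrow> coxeter_eq v u"
| trans: "coxeter_eq u v \<Longrightarrow> coxeter_eq v w \<Longrightarrow> coxeter_eq u w"
| append: "coxeter_eq u u' \<Longrightarrow> coxeter_eq v v' \<Longrightarrow> coxeter_eq (u @ v) (u' @ v')"
| involution: "coxeter_eq [i, i] []"
| order3: "i \<noteq> j \<Longrightarrow> coxeter_eq [i, j, i, j, i, j] []"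

quotient_type affine_A2 = "node list" / coxeter_eq
  morphisms rep_word word
proof (intro equivpI reflpI sympI transpI)
  fix u v w
  show "coxeter_eq u u"
    by (rule coxeter_eq.refl)
  show "coxeter_eq v u" if "coxeter_eq u v"
    using that by (rule coxeter_eq.sym)
  show "coxeter_eq u w" if "coxeter_eq u v" "coxeter_eq v w"
    using that by (rule coxeter_eq.trans)
qed

lemma coxeter_eq_rev: "coxeter_eq u v \<Longrightarrow> coxeter_eq (rev u) (rev v)"
proof (induction rule: coxeter_eq.induct)
  case (trans u v w)
  from trans.IH show ?case by (rule coxeter_eq.trans)
next
  case (order3 i j)
  from order3[symmetric] coxeter_eq.order3[of j i] show ?case by simp
qed (simp_all add: coxeter_eq.refl coxeter_eq.sym coxeter_eq.append coxeter_eq.involution)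

instantiation affine_A2 :: "{monoid_mult, inverse}"
begin

lift_definition one_affine_A2 :: affine_A2 is "[]" .

lift_definition times_affine_A2 :: "affine_A2 \<Rightarrow> affine_A2 \<Rightarrow> affine_A2" is "(@)"
  by (rule coxeter_eq.append)

lift_definition inverse_affine_A2 :: "affine_A2 \<Rightarrow> affine_A2" is rev
  by (rule coxeter_eq_rev)

definition "x div y = x * inverse y" for x y :: affine_A2

instance
proof
  fix x y z :: affine_A2
  show "x * y * z = x * (y * z)"
    by transfer (simp add: coxeter_eq.refl)
  show "1 * x = x"
    by transfer (simp add: coxeter_eq.refl)
  show "x * 1 = x"
    by transfer (simp add: coxeter_eq.refl)
qed

end

lemma affine_A2_left_inverse: "inverse x * x = (1 :: affine_A2)"
proof (transfer)
  have cancel: "coxeter_eq (rev u @ u) []" for u :: "node list"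
  proof (induction u)
    case (Cons a u)
    have "coxeter_eq (rev u @ ([a, a] @ u)) (rev u @ ([] @ u))"
      by (intro coxeter_eq.append coxeter_eq.refl coxeter_eq.involution)
    then have "coxeter_eq (rev (a # u) @ a # u) (rev u @ u)"
      by simp
    with Cons.IH show ?case
      by (rule coxeter_eq.trans[rotated])
  qed (simp add: coxeter_eq.refl)
  fix u :: "node list"
  show "coxeter_eq (rev u @ u) []"
    by (rule cancel)
qed

lemma affine_A2_right_inverse: "x * inverse x = (1 :: affine_A2)"
proof -
  have "inverse (inverse x) = x"
    by transfer (simp add: coxeter_eq.refl)
  with affine_A2_left_inverse[of "inverse x"] show ?thesis by simp
qed

definition simple_reflection :: "node \<Rightarrow> affine_A2" where
  "simple_reflection i = word [i]"

definition len :: "affine_A2 \<Rightarrow> nat" where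
  "len w = (LEAST n. \<exists>u. length u = n \<and> word u = w)"

definition reflections :: "affine_A2 set" where
  "reflections = {x * simple_reflection i * inverse x | x i. True}"

text \<open>The Bruhat order is generated by \<open>x < r x\<close> for reflections \<open>r\<close> with
  \<open>len x < len (r x)\<close>.\<close>

definition bruhat_step :: "affine_A2 \<Rightarrow> affine_A2 \<Rightarrow> bool" where
  "bruhat_step x y \<longleftrightarrow> (\<exists>r\<in>reflections. y = r * x \<and> len x < len y)"

lemma bruhat_step_len: "bruhat_step\<^sup>*\<^sup>* x y \<Longrightarrow> x = y \<or> len x < len y"
  by (induction rule: rtranclp_induct) (auto simp: bruhat_step_def)

instantiation affine_A2 :: order
begin

definition less_eq_affine_A2 :: "affine_A2 \<Rightarrow> affine_A2 \<Rightarrow> bool" where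
  "x \<le> y \<longleftrightarrow> bruhat_step\<^sup>*\<^sup>* x y"

definition less_affine_A2 :: "affine_A2 \<Rightarrow> affine_A2 \<Rightarrow> bool" where
  "less_affine_A2 x y \<longleftrightarrow> x \<le> y \<and> x \<noteq> y"

instance
proof
  fix x y z :: affine_A2
  show antisym: "x = y" if "x \<le> y" "y \<le> x"
    using that bruhat_step_len[of x y] bruhat_step_len[of y x]
    by (auto simp: less_eq_affine_A2_def)
  show "x < y \<longleftrightarrow> x \<le> y \<and> \<not> y \<le> x"
    using bruhat_step_len[of x y] bruhat_step_len[of y x]
    by (auto simp: less_eq_affine_A2_def less_affine_A2_def)
  show "x \<le> x"
    by (simp add: less_eq_affine_A2_def)
  show "x \<le> z" if "x \<le> y" "y \<le> z"
    using that by (simp add: less_eq_affine_A2_def)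
qed

end

definition bruhat_n :: "affine_A2 \<Rightarrow> affine_A2 \<Rightarrow> nat" where
  "bruhat_n w x = card {r \<in> reflections. r * x \<le> w}"

definition bruhat_q :: "affine_A2 \<Rightarrow> affine_A2 \<Rightarrow> int" where
  "bruhat_q w x = int (bruhat_n w x) - int (len w)"

lemma bruhat_n_finite: "finite {r \<in> reflections. r * x \<le> w}"
proof -
  have "UNIV \<subseteq> {N0, N1, N2}"
    using node.exhaust by blast
  then have fin: "finite (UNIV :: node set)"
    by (rule finite_subset) simp
  have word: "\<exists>u. length u = len y \<and> word u = y" for y
  proof -
    obtain u where "word u = y"
      by (metis Quotient_abs_rep[OF Quotient_affine_A2])
    then have "\<exists>n u. length u = n \<and> word u = y"
      by blast
    then show ?thesis
      unfolding len_def by (rule LeastI_ex)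
  qed
  have "len y \<le> len w" if "y \<le> w" for y
    using that bruhat_step_len[of y w] by (auto simp: less_eq_affine_A2_def)
  then have "{y. y \<le> w} \<subseteq> word ` {u. set u \<subseteq> UNIV \<and> length u \<le> len w}"
    using word by (smt (verit) image_eqI mem_Collect_eq subset_UNIV subsetI)
  moreover have "finite {u :: node list. set u \<subseteq> UNIV \<and> length u \<le> len w}"
    using fin by (rule finite_lists_length_le)
  ultimately have "finite {y. y \<le> w}"
    using finite_surj by blast
  moreover have "inj_on (\<lambda>r. r * x) {r \<in> reflections. r * x \<le> w}"
    by (rule inj_on_inverseI[where g = "\<lambda>y. y * inverse x"])
       (simp add: mult.assoc affine_A2_right_inverse)
  moreover have "(\<lambda>r. r * x) ` {r \<in> reflections. r * x \<le> w} \<subseteq> {y. y \<le> w}"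
    by blast
  ultimately show ?thesis
    using inj_on_finite by blast
qed


section \<open>The Kac--Moody group and its flag variety\<close>

text \<open>The Kac--Moody group of affine type A2 is realised as the loop group of SL(3) over the
  Laurent polynomials, the variable being \<open>fls_X\<close>. Central extensions, the rotation torus and
  completions of the group enlarge the group and its Borel subgroup simultaneously, and do not
  change the flag variety or its Schubert varieties.\<close>

type_synonym loop = "complex fls ^ 3 ^ 3"

definition loop_group :: "loop set" where
  "loop_group = {g. det g = 1 \<and> (\<forall>i j. finite {k. fls_nth (g $ i $ j) k \<noteq> 0})}"

text \<open>The Borel subgroup: polynomial matrices that are upper triangular at \<open>fls_X = 0\<close>.\<close>

definition borel_subgroup :: "loop set" where
  "borel_subgroup = {g \<in> loop_group.
     (\<forall>i j. \<forall>k<0. fls_nth (g $ i $ j) k = 0) \<and>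
     fls_nth (g $ 2 $ 1) 0 = 0 \<and> fls_nth (g $ 3 $ 1) 0 = 0 \<and> fls_nth (g $ 3 $ 2) 0 = 0}"

text \<open>Lifts of the simple reflections to the normaliser of the diagonal torus, each of the form
  \<open>exp e * exp (- f) * exp e\<close>; for \<open>N0\<close>, \<open>e\<close> is \<open>fls_X\<close> times the matrix unit \<open>(3, 1)\<close>.\<close>

fun simple_lift :: "node \<Rightarrow> loop" where
  "simple_lift N0 = vector [vector [0, 0, - fls_X_inv], vector [0, 1, 0], vector [fls_X, 0, 0]]"
| "simple_lift N1 = vector [vector [0, 1, 0], vector [- 1, 0, 0], vector [0, 0, 1]]"
| "simple_lift N2 = vector [vector [1, 0, 0], vector [0, 0, 1], vector [0, - 1, 0]]"

text \<open>Different words for the same Weyl group element give lifts that differ by an element of the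
  torus, so the coset of \<open>weyl_lift x\<close> does not depend on the chosen word.\<close>

definition weyl_lift :: "affine_A2 \<Rightarrow> loop" where
  "weyl_lift x = foldr (\<lambda>i g. simple_lift i ** g) (SOME u. word u = x) (mat 1)"

definition borel_coset :: "loop \<Rightarrow> loop set" where
  "borel_coset g = {g ** b | b. b \<in> borel_subgroup}"

definition torus_fixed_point :: "affine_A2 \<Rightarrow> loop set" where
  "torus_fixed_point x = borel_coset (weyl_lift x)"

definition schubert_cell :: "affine_A2 \<Rightarrow> loop set set" where
  "schubert_cell x = {borel_coset (b ** weyl_lift x) | b. b \<in> borel_subgroup}"

text \<open>The loop group is the increasing union of the finite-dimensional affine varieties
  \<open>loop_filtration n\<close>. It carries the direct limit of their classical topologies, the flag
  variety carries the quotient topology, and this induces the classical topology on Schubert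
  varieties.\<close>

definition loop_filtration :: "nat \<Rightarrow> loop set" where
  "loop_filtration n =
     {g \<in> loop_group. \<forall>i j k. \<bar>k\<bar> > int n \<longrightarrow> fls_nth (g $ i $ j) k = 0}"

definition loop_coeffs :: "loop \<Rightarrow> 3 \<times> 3 \<times> int \<Rightarrow> complex" where
  "loop_coeffs g = (\<lambda>(i, j, k). fls_nth (g $ i $ j) k)"

definition loop_filtration_topology :: "nat \<Rightarrow> loop topology" where
  "loop_filtration_topology n = pullback_topology (loop_filtration n) loop_coeffs euclidean"

definition loop_topology :: "loop topology" where
  "loop_topology = topology (\<lambda>U. U \<subseteq> loop_group \<and>
     (\<forall>n. openin (loop_filtration_topology n) (U \<inter> loop_filtration n)))"

lemma openin_loop_topology:
  "openin loop_topology U \<longleftrightarrow> U \<subseteq> loop_group \<and>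
     (\<forall>n. openin (loop_filtration_topology n) (U \<inter> loop_filtration n))"
proof -
  have "istopology (\<lambda>U. U \<subseteq> loop_group \<and>
     (\<forall>n. openin (loop_filtration_topology n) (U \<inter> loop_filtration n)))"
    unfolding istopology_def
  proof (intro conjI allI impI; (elim conjE)?)
    fix S T n
    assume "\<forall>n. openin (loop_filtration_topology n) (S \<inter> loop_filtration n)"
      "\<forall>n. openin (loop_filtration_topology n) (T \<inter> loop_filtration n)"
    then have "openin (loop_filtration_topology n)
        ((S \<inter> loop_filtration n) \<inter> (T \<inter> loop_filtration n))"
      by blast
    then show "openin (loop_filtration_topology n) (S \<inter> T \<inter> loop_filtration n)"
      by (simp add: Int_ac)
  next
    fix K n
    assume "\<forall>S\<in>K. S \<subseteq> loop_group \<and>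
      (\<forall>n. openin (loop_filtration_topology n) (S \<inter> loop_filtration n))"
    then have "openin (loop_filtration_topology n) (\<Union>S\<in>K. S \<inter> loop_filtration n)"
      by blast
    then show "openin (loop_filtration_topology n) (\<Union>K \<inter> loop_filtration n)"
      by (simp only: Int_Union2)
  qed auto
  then show ?thesis
    by (simp add: loop_topology_def)
qed

definition flag_topology :: "loop set topology" where
  "flag_topology = topology (\<lambda>V. V \<subseteq> borel_coset ` loop_group \<and>
     openin loop_topology {g \<in> loop_group. borel_coset g \<in> V})"

lemma openin_flag_topology:
  "openin flag_topology V \<longleftrightarrow> V \<subseteq> borel_coset ` loop_group \<and>
     openin loop_topology {g \<in> loop_group. borel_coset g \<in> V}"
proof -
  have "istopology (\<lambda>V. V \<subseteq> borel_coset ` loop_group \<and>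
     openin loop_topology {g \<in> loop_group. borel_coset g \<in> V})"
    unfolding istopology_def
  proof (intro conjI allI impI; (elim conjE)?)
    fix S T
    assume "openin loop_topology {g \<in> loop_group. borel_coset g \<in> S}"
      "openin loop_topology {g \<in> loop_group. borel_coset g \<in> T}"
    then have "openin loop_topology
        ({g \<in> loop_group. borel_coset g \<in> S} \<inter> {g \<in> loop_group. borel_coset g \<in> T})"
      by blast
    moreover have "{g \<in> loop_group. borel_coset g \<in> S} \<inter> {g \<in> loop_group. borel_coset g \<in> T}
        = {g \<in> loop_group. borel_coset g \<in> S \<inter> T}"
      by blast
    ultimately show "openin loop_topology {g \<in> loop_group. borel_coset g \<in> S \<inter> T}"
      by simp
  next
    fix K
    assume "\<forall>S\<in>K. S \<subseteq> borel_coset ` loop_group \<and>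
      openin loop_topology {g \<in> loop_group. borel_coset g \<in> S}"
    then have "openin loop_topology (\<Union>S\<in>K. {g \<in> loop_group. borel_coset g \<in> S})"
      by blast
    moreover have "(\<Union>S\<in>K. {g \<in> loop_group. borel_coset g \<in> S})
        = {g \<in> loop_group. borel_coset g \<in> \<Union>K}"
      by blast
    ultimately show "openin loop_topology {g \<in> loop_group. borel_coset g \<in> \<Union>K}"
      by simp
  qed auto
  then show ?thesis
    by (simp add: flag_topology_def)
qed

definition schubert_variety :: "affine_A2 \<Rightarrow> loop set topology" where
  "schubert_variety w = subtopology flag_topology (\<Union>x\<in>{x. x \<le> w}. schubert_cell x)"


section \<open>Relative rational singular cohomology and rational smoothness\<close>

text \<open>A relative cochain is given by its values on singular simplices; it vanishes on those that
  lie in \<open>S\<close> and, by convention, on functions that are not singular simplices of \<open>X\<close>.\<close>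

definition rel_cochains ::
    "nat \<Rightarrow> 'a topology \<Rightarrow> 'a set \<Rightarrow> (((nat \<Rightarrow> real) \<Rightarrow> 'a) \<Rightarrow> rat) set" where
  "rel_cochains p X S = {\<phi>. \<forall>f. \<phi> f \<noteq> 0 \<longrightarrow>
     singular_simplex p X f \<and> \<not> singular_simplex p (subtopology X S) f}"

definition cochain_eval ::
    "(((nat \<Rightarrow> real) \<Rightarrow> 'a) \<Rightarrow> rat) \<Rightarrow> 'a chain \<Rightarrow> rat" where
  "cochain_eval \<phi> c = (\<Sum>f\<in>Poly_Mapping.keys c. of_int (Poly_Mapping.lookup c f) * \<phi> f)"

definition coboundary ::
    "nat \<Rightarrow> 'a topology \<Rightarrow> (((nat \<Rightarrow> real) \<Rightarrow> 'a) \<Rightarrow> rat) \<Rightarrow> ((nat \<Rightarrow> real) \<Rightarrow> 'a) \<Rightarrow> rat" where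
  "coboundary p X \<phi> f =
     (if singular_simplex (Suc p) X f
      then cochain_eval \<phi> (chain_boundary (Suc p) (frag_of f)) else 0)"

definition rel_cocycle_group ::
    "nat \<Rightarrow> 'a topology \<Rightarrow> 'a set \<Rightarrow> (((nat \<Rightarrow> real) \<Rightarrow> 'a) \<Rightarrow> rat) monoid" where
  "rel_cocycle_group p X S =
     \<lparr>carrier = {\<phi> \<in> rel_cochains p X S. coboundary p X \<phi> = (\<lambda>_. 0)},
      monoid.mult = (\<lambda>\<phi> \<psi> f. \<phi> f + \<psi> f), one = (\<lambda>_. 0)\<rparr>"

definition rel_coboundaries ::
    "nat \<Rightarrow> 'a topology \<Rightarrow> 'a set \<Rightarrow> (((nat \<Rightarrow> real) \<Rightarrow> 'a) \<Rightarrow> rat) set" where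
  "rel_coboundaries p X S =
     (case p of 0 \<Rightarrow> {\<lambda>_. 0} | Suc m \<Rightarrow> coboundary m X ` rel_cochains m X S)"

definition rel_cohomology ::
    "nat \<Rightarrow> 'a topology \<Rightarrow> 'a set \<Rightarrow> (((nat \<Rightarrow> real) \<Rightarrow> 'a) \<Rightarrow> rat) set monoid" where
  "rel_cohomology p X S = rel_cocycle_group p X S Mod rel_coboundaries p X S"

text \<open>An additive isomorphism between rational vector spaces is automatically linear, so it is
  enough to record the additive groups.\<close>

definition rational_group :: "rat monoid" where
  "rational_group = \<lparr>carrier = UNIV, monoid.mult = (+), one = 0\<rparr>"

text \<open>Here \<open>d\<close> is the complex dimension of \<open>Y\<close>.\<close>

definition rationally_smooth :: "'a topology \<Rightarrow> nat \<Rightarrow> 'a \<Rightarrow> bool" where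
  "rationally_smooth Y d p \<longleftrightarrow>
     (\<exists>U. openin Y U \<and> p \<in> U \<and>
       (\<forall>y\<in>U. \<forall>i. if i = 2 * d
          then rel_cohomology i Y (topspace Y - {y}) \<cong> rational_group
          else trivial_group (rel_cohomology i Y (topspace Y - {y}))))"

end

theory Submission
  imports Defs
begin

text \<open>By the Carrell--Peterson criterion only the combinatorics of the Bruhat order is left: if some
  \<open>y\<close> between \<open>x\<close> and \<open>w\<close> has \<open>q > 0\<close>, then so has \<open>x\<close> or some \<open>r x\<close> above \<open>x\<close>. Identify group elements
  with alcoves. The interval below \<open>w\<close> is a hexagon whose sides are parallel to the roots, and
  the alcoves \<open>r x\<close> with \<open>r\<close> a reflection in a given direction are every second alcove of the strip
  through \<open>x\<close> in that direction. So \<open>n\<close> is a sum of three chord lengths, each of them a minimum of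
  affine functions of the position of \<open>x\<close>, up to rounding. If \<open>w\<close> is not a spiral, it follows that
  \<open>q > 0\<close> holds exactly on a union of at most two smaller hexagons, which is closed downwards in the
  Bruhat order, so \<open>x\<close> itself has \<open>q > 0\<close>. If \<open>w\<close> is a spiral, the hexagon is a triangle, on which the
  sum of the chord lengths is constant up to rounding; then \<open>q > 0\<close> holds on some residue classes
  of a smaller triangle, and one reflection leads from the other classes to one of those.\<close>

section \<open>Alcoves\<close>

text \<open>An alcove is recorded by the strips it lies in, one for each of the three directions of
  walls; the coordinates are shifted so that the fundamental alcove is \<open>(0, 0, 0)\<close>. The triples
  that occur are those with coordinate sum 0 or -1, and the number of walls between an alcove
  and the fundamental one is the sum of the absolute values.\<close>

type_synonym alcove = "int \<times> int \<times> int"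

definition alcoves :: "alcove set" where
  "alcoves = {(a, b, c). a + b + c = 0 \<or> a + b + c = -1}"

fun alen :: "alcove \<Rightarrow> nat" where
  "alen (a, b, c) = nat (\<bar>a\<bar> + \<bar>b\<bar> + \<bar>c\<bar>)"

fun coord :: "node \<Rightarrow> alcove \<Rightarrow> int" where
  "coord N1 (a, b, c) = a"
| "coord N2 (a, b, c) = b"
| "coord N0 (a, b, c) = c"

text \<open>\<open>reflect i m\<close> is the reflection in the wall between the strips \<open>m - 1\<close> and \<open>m\<close> of
  direction \<open>i\<close>; the simple reflections are the \<open>reflect i 0\<close>.\<close>

fun reflect :: "node \<Rightarrow> int \<Rightarrow> alcove \<Rightarrow> alcove" where
  "reflect N1 m (a, b, c) = (2 * m - 1 - a, - c - m, - b - m)"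
| "reflect N2 m (a, b, c) = (- c - m, 2 * m - 1 - b, - a - m)"
| "reflect N0 m (a, b, c) = (- b - m, - a - m, 2 * m - 1 - c)"

lemma reflect_reflect [simp]: "reflect i m (reflect i m x) = x"
  by (cases x; cases i) simp_all

lemma reflect_in_alcoves [simp]: "reflect i m x \<in> alcoves \<longleftrightarrow> x \<in> alcoves"
  by (cases x; cases i) (auto simp: alcoves_def)

lemma alen_less_iff:
  "alen (a, b, c) < alen (a', b', c') \<longleftrightarrow> \<bar>a\<bar> + \<bar>b\<bar> + \<bar>c\<bar> < \<bar>a'\<bar> + \<bar>b'\<bar> + \<bar>c'\<bar>"
  by (simp only: alen.simps nat_less_eq_zless abs_ge_zero add_nonneg_nonneg)

text \<open>A reflection lengthens exactly when the alcove and the fundamental one lie on the same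
  side of the wall, which the coordinate in that direction alone decides. Parity excludes
  ties.\<close>

lemma abs_sum_less_iff:
  fixes a b c m :: int
  assumes "a + b + c = 0 \<or> a + b + c = -1"
  shows "\<bar>a\<bar> + \<bar>b\<bar> + \<bar>c\<bar> < \<bar>2 * m - 1 - a\<bar> + \<bar>- c - m\<bar> + \<bar>- b - m\<bar> \<longleftrightarrow>
    \<bar>a\<bar> < \<bar>2 * m - 1 - a\<bar>"
proof -
  have "a \<noteq> 2 * m - 1 - a" "a \<noteq> - (2 * m - 1 - a)"
    by presburger+
  with assms show ?thesis
    by (elim disjE; smt (verit))
qed

lemma alen_reflect_iff:
  assumes "x \<in> alcoves"
  shows "alen x < alen (reflect i m x) \<longleftrightarrow> \<bar>coord i x\<bar> < \<bar>coord i (reflect i m x)\<bar>"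
proof (cases x)
  case (fields a b c)
  have s: "a + b + c = 0 \<or> a + b + c = -1" "b + c + a = 0 \<or> b + c + a = -1"
    "c + a + b = 0 \<or> c + a + b = -1"
    using assms by (auto simp: alcoves_def fields)
  show ?thesis
    using abs_sum_less_iff[OF s(1), of m] abs_sum_less_iff[OF s(2), of m]
      abs_sum_less_iff[OF s(3), of m]
    unfolding fields by (cases i) (simp_all only: reflect.simps coord.simps alen_less_iff ac_simps)
qed

section \<open>The Bruhat order on alcoves\<close>

definition up :: "alcove \<Rightarrow> alcove \<Rightarrow> bool" where
  "up x y \<longleftrightarrow> alen x < alen y \<and> (\<exists>i m. y = reflect i m x)"

definition below :: "alcove \<Rightarrow> alcove set" where
  "below w = {x. up\<^sup>*\<^sup>* x w}"

definition refl_count :: "alcove \<Rightarrow> alcove \<Rightarrow> nat" where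
  "refl_count w x = card {(i, m). reflect i m x \<in> below w}"

lemma up_in_alcoves: "up x y \<Longrightarrow> x \<in> alcoves \<longleftrightarrow> y \<in> alcoves"
  by (auto simp: up_def)

lemma rtranclp_up_in_alcoves: "up\<^sup>*\<^sup>* x y \<Longrightarrow> x \<in> alcoves \<longleftrightarrow> y \<in> alcoves"
  by (induction rule: rtranclp_induct) (auto simp: up_in_alcoves)

lemma below_refl [simp]: "w \<in> below w"
  by (simp add: below_def)

lemma up_below: "up x y \<Longrightarrow> y \<in> below w \<Longrightarrow> x \<in> below w"
  by (simp add: below_def)

lemma below_trans: "x \<in> below y \<Longrightarrow> y \<in> below z \<Longrightarrow> x \<in> below z"
  by (simp add: below_def)

text \<open>Conjugation by \<open>reflect j 0\<close> turns a wall of direction i different from j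
  into one of the third direction, and the coordinates that decide about the step keep their
  absolute values. For i = j the coordinate a becomes -1 - a, and only m = 0 can spoil the
  step.\<close>

lemma up_simple:
  assumes "x \<in> alcoves" "up x y"
  shows "reflect j 0 x = y \<or> up (reflect j 0 x) (reflect j 0 y)"
proof (rule disjCI)
  assume ne: "\<not> up (reflect j 0 x) (reflect j 0 y)"
  from assms(2) obtain i m where y: "y = reflect i m x" and len: "alen x < alen y"
    by (auto simp: up_def)
  define k where "k = (if i = j then i else if i \<noteq> N0 \<and> j \<noteq> N0 then N0
    else if i \<noteq> N1 \<and> j \<noteq> N1 then N1 else N2)"
  have conj: "reflect j 0 y = reflect k (if i = j then - m else 1 - m) (reflect j 0 x)"
    unfolding y k_def by (cases x; cases i; cases j) simp_all
  have "\<not> alen (reflect j 0 x) < alen (reflect j 0 y)"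
    using ne conj by (auto simp: up_def)
  then have noless: "\<not> \<bar>coord k (reflect j 0 x)\<bar> < \<bar>coord k (reflect j 0 y)\<bar>"
    using alen_reflect_iff[of "reflect j 0 x" k] assms(1) conj by simp
  moreover have less: "\<bar>coord i x\<bar> < \<bar>coord i y\<bar>"
    using alen_reflect_iff[of x i m] assms(1) len y by simp
  moreover have "\<bar>coord k (reflect j 0 z)\<bar> = \<bar>coord i z\<bar>" if "i \<noteq> j" for z
    using that unfolding k_def by (cases z; cases i; cases j) simp_all
  ultimately have "i = j" by metis
  then have "\<not> \<bar>coord i (reflect i 0 x)\<bar> < \<bar>coord i (reflect i 0 y)\<bar>"
    using noless unfolding k_def by simp
  then have "m = 0"
    using less unfolding y by (cases x; cases i; simp; arith)
  with \<open>i = j\<close> y show "reflect j 0 x = y" by simp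
qed

text \<open>This is the lifting property. Each step of a chain survives \<open>reflect i 0\<close>
  by \<open>up_simple\<close>, unless it is \<open>reflect i 0\<close> itself; there the unreflected
  rest of the chain already ends in \<open>y\<close>.\<close>

lemma below_simple_cases:
  assumes "x \<in> below y" "y \<in> alcoves"
  shows "reflect i 0 x \<in> below y \<or> reflect i 0 x \<in> below (reflect i 0 y)"
proof -
  from assms(1) have "up\<^sup>*\<^sup>* x y" by (simp add: below_def)
  then show ?thesis
  proof (induction rule: converse_rtranclp_induct)
    case (step x x')
    have "x \<in> alcoves"
      using step.hyps assms(2) rtranclp_up_in_alcoves up_in_alcoves by blast
    from up_simple[OF this step.hyps(1), of i] show ?case
      using step.IH step.hyps(2) by (auto simp: below_def intro: converse_rtranclp_into_rtranclp)
  qed (simp add: below_def)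
qed

lemma below_lift:
  assumes "w \<in> alcoves" "alen (reflect i 0 w) < alen w" "x \<in> below (reflect i 0 w)"
  shows "x \<in> below w" "reflect i 0 x \<in> below w"
proof -
  have "up (reflect i 0 w) w"
    unfolding up_def using assms(2) reflect_reflect[of i 0 w, symmetric] by blast
  then have le: "below (reflect i 0 w) \<subseteq> below w"
    using below_trans up_below[OF _ below_refl] by blast
  with assms(3) show "x \<in> below w" by blast
  show "reflect i 0 x \<in> below w"
    using below_simple_cases[OF assms(3), of i] assms(1) le by auto
qed

text \<open>When a simple reflection shortens w, the lifting property puts both the interval below
  the shorter element and its mirror image below w. So covering \<open>X\<close> by these two gives
  one inclusion, and down-closure gives the other.\<close>

lemma below_eqI:
  assumes "w \<in> alcoves" "w \<in> X"
    and down: "\<And>x y. up x y \<Longrightarrow> y \<in> X \<Longrightarrow> x \<in> X"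
    and desc: "alen (reflect i 0 w) < alen w"
    and cover: "\<And>x. x \<in> X \<Longrightarrow> x \<in> below (reflect i 0 w) \<or> reflect i 0 x \<in> below (reflect i 0 w)"
  shows "below w = X"
proof
  show "below w \<subseteq> X"
  proof
    fix x assume "x \<in> below w"
    then have "up\<^sup>*\<^sup>* x w" by (simp add: below_def)
    then show "x \<in> X"
      by (induction rule: converse_rtranclp_induct) (use assms(2) down in blast)+
  qed
  show "X \<subseteq> below w"
  proof
    fix x assume "x \<in> X"
    from cover[OF this] show "x \<in> below w"
    proof
      assume "reflect i 0 x \<in> below (reflect i 0 w)"
      from below_lift(2)[OF assms(1) desc this] show ?thesis by simp
    qed (rule below_lift(1)[OF assms(1) desc])
  qed
qed

section \<open>Hexagonal regions\<close>

text \<open>Reflections of direction \<open>N1\<close> fix b - c, those of \<open>N2\<close> fix c -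
  a, those of \<open>N0\<close> fix a - b. The level lines of these differences are therefore
  parallel to the roots, and the six bounds cut out a hexagon.\<close>

definition region :: "int \<Rightarrow> int \<Rightarrow> int \<Rightarrow> int \<Rightarrow> int \<Rightarrow> int \<Rightarrow> alcove set" where
  "region l1 l2 l3 u1 u2 u3 = {(a, b, c) \<in> alcoves.
     l1 \<le> b - c \<and> b - c \<le> u1 \<and> l2 \<le> c - a \<and> c - a \<le> u2 \<and> l3 \<le> a - b \<and> a - b \<le> u3}"

text \<open>The reflection moves the alcove outwards along a chord, so two of the bounds are
  inherited directly. The other two come from the mirrored sides; the shift by 3 * m leaves room for
  the permitted differences between \<open>l2\<close> and \<open>l3\<close> and between
  \<open>u2\<close> and \<open>u3\<close>.\<close>

lemma strip_bounds:
  fixes a b c m :: int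
  assumes "a + b + c = 0 \<or> a + b + c = -1" "\<bar>a\<bar> < \<bar>2 * m - 1 - a\<bar>"
    and "l2 \<le> l3 + 1" "l3 \<le> l2 + 2" "u2 \<le> u3 + 1" "u3 \<le> u2 + 2"
    and "l2 \<le> (- b - m) - (2 * m - 1 - a)" "(- b - m) - (2 * m - 1 - a) \<le> u2"
    and "l3 \<le> (2 * m - 1 - a) - (- c - m)" "(2 * m - 1 - a) - (- c - m) \<le> u3"
  shows "l2 \<le> c - a \<and> c - a \<le> u2 \<and> l3 \<le> a - b \<and> a - b \<le> u3"
proof -
  have "1 \<le> m \<and> a \<le> m - 1 \<or> m \<le> 0 \<and> m \<le> a"
    using assms(2) by arith
  then show ?thesis
    using assms(1,3-) by (elim disjE conjE; intro conjI; linarith)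
qed

text \<open>The side conditions make the lower bounds nearly equal, and likewise the upper ones: up
  to rounding the hexagon has the threefold symmetry of the fundamental alcove. The three directions
  are cyclic copies of \<open>strip_bounds\<close>.\<close>

lemma region_down_closed:
  assumes "up x y" "y \<in> region l1 l2 l3 u1 u2 u3"
    and "l1 \<le> l2 + 1" "l2 \<le> l1 + 2" "l2 \<le> l3 + 1" "l3 \<le> l2 + 2" "l3 \<le> l1 + 1" "l1 \<le> l3 + 2"
    and "u1 \<le> u2 + 1" "u2 \<le> u1 + 2" "u2 \<le> u3 + 1" "u3 \<le> u2 + 2" "u3 \<le> u1 + 1" "u1 \<le> u3 + 2"
  shows "x \<in> region l1 l2 l3 u1 u2 u3"
proof -
  obtain i m where y: "y = reflect i m x" and len: "alen x < alen y"
    using assms(1) by (auto simp: up_def)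
  obtain a b c where x: "x = (a, b, c)" by (cases x)
  have "x \<in> alcoves"
    using assms(1,2) up_in_alcoves by (auto simp: region_def)
  then have s: "a + b + c = 0 \<or> a + b + c = -1" "b + c + a = 0 \<or> b + c + a = -1"
    "c + a + b = 0 \<or> c + a + b = -1"
    by (auto simp: alcoves_def x)
  have less: "\<bar>coord i x\<bar> < \<bar>coord i y\<bar>"
    using alen_reflect_iff[of x i m] len y \<open>x \<in> alcoves\<close> by simp
  show ?thesis
  proof (cases i)
    case N1
    then show ?thesis
      using strip_bounds[OF s(1), of m l2 l3 u2 u3] less assms(2-) \<open>x \<in> alcoves\<close>
      unfolding y x by (simp add: region_def)
  next
    case N2
    then show ?thesis
      using strip_bounds[OF s(2), of m l3 l1 u3 u1] less assms(2-) \<open>x \<in> alcoves\<close>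
      unfolding y x by (simp add: region_def)
  next
    case N0
    then show ?thesis
      using strip_bounds[OF s(3), of m l1 l2 u1 u2] less assms(2-) \<open>x \<in> alcoves\<close>
      unfolding y x by (simp add: region_def)
  qed
qed

section \<open>Bruhat intervals\<close>

definition symmetry :: "(alcove \<Rightarrow> alcove) \<Rightarrow> (node \<Rightarrow> node) \<Rightarrow> bool" where
  "symmetry f p \<longleftrightarrow> bij f \<and> bij p \<and> (\<forall>x. alen (f x) = alen x) \<and>
     (\<forall>i m x. f (reflect i m x) = reflect (p i) m (f x))"

lemma symmetryD:
  assumes "symmetry f p"
  shows "bij f" "bij p" "alen (f x) = alen x" "f (reflect i m x) = reflect (p i) m (f x)"
  using assms unfolding symmetry_def by blast+

lemma symmetry_inv:
  assumes "symmetry f p"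
  shows "symmetry (inv_into UNIV f) (inv_into UNIV p)"
proof -
  have bij: "bij f" "bij p"
    by (rule symmetryD[OF assms])+
  have f: "f (inv_into UNIV f x) = x" "inv_into UNIV f (f x) = x" and p: "p (inv_into UNIV p i) = i" for x i
    using bij by (simp_all add: bij_is_surj surj_f_inv_f bij_is_inj)
  have "alen (inv_into UNIV f x) = alen x" for x
    using symmetryD(3)[OF assms, of "inv_into UNIV f x"] f(1) by simp
  moreover have "inv_into UNIV f (reflect i m x) = reflect (inv_into UNIV p i) m (inv_into UNIV f x)" for i m x
    using symmetryD(4)[OF assms, of "inv_into UNIV p i" m "inv_into UNIV f x"] f p by metis
  ultimately show ?thesis
    using bij by (simp add: symmetry_def bij_imp_bij_inv)
qed

lemma symmetry_up: "symmetry f p \<Longrightarrow> up x y \<Longrightarrow> up (f x) (f y)"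
  using symmetryD(3,4) unfolding up_def by metis

lemma symmetry_below_imp:
  assumes "symmetry f p" "x \<in> below w"
  shows "f x \<in> below (f w)"
proof -
  from assms(2) have "up\<^sup>*\<^sup>* x w" by (simp add: below_def)
  then have "up\<^sup>*\<^sup>* (f x) (f w)"
  proof (induction rule: rtranclp_induct)
    case (step y z)
    then show ?case
      using symmetry_up[OF assms(1)] by (meson rtranclp.rtrancl_into_rtrancl)
  qed simp
  then show ?thesis by (simp add: below_def)
qed

lemma symmetry_below: "symmetry f p \<Longrightarrow> f x \<in> below (f w) \<longleftrightarrow> x \<in> below w"
  using symmetry_below_imp[of f p x w] symmetry_below_imp[OF symmetry_inv, of f p "f x" "f w"]
  by (auto simp: bij_is_inj symmetryD(1))

lemma symmetry_refl_count:
  assumes "symmetry f p"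
  shows "refl_count (f w) (f x) = refl_count w x"
proof -
  have bij: "bij p" by (rule symmetryD(2)[OF assms])
  have "{(i, m). reflect i m (f x) \<in> below (f w)} = map_prod p id ` {(i, m). reflect i m x \<in> below w}"
  proof (intro Set.set_eqI iffI)
    fix y assume "y \<in> {(i, m). reflect i m (f x) \<in> below (f w)}"
    then obtain i m where y: "y = (i, m)" "reflect i m (f x) \<in> below (f w)" by auto
    have i: "p (inv_into UNIV p i) = i" using bij by (simp add: bij_is_surj surj_f_inv_f)
    with y(2) have "f (reflect (inv_into UNIV p i) m x) \<in> below (f w)"
      by (simp add: symmetryD(4)[OF assms])
    then have "reflect (inv_into UNIV p i) m x \<in> below w"
      by (simp add: symmetry_below[OF assms])
    then show "y \<in> map_prod p id ` {(i, m). reflect i m x \<in> below w}"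
      using i y(1) by (intro image_eqI[of _ _ "(inv_into UNIV p i, m)"]) auto
  next
    fix y assume "y \<in> map_prod p id ` {(i, m). reflect i m x \<in> below w}"
    then obtain i m where "y = (p i, m)" "reflect i m x \<in> below w" by auto
    then show "y \<in> {(i, m). reflect i m (f x) \<in> below (f w)}"
      using symmetry_below_imp[OF assms, of "reflect i m x" w] by (simp add: symmetryD(4)[OF assms])
  qed
  moreover have "inj_on (map_prod p id) {(i, m). reflect i m x \<in> below w}" for x :: alcove
    using bij by (intro inj_on_subset[OF prod.inj_map]) (auto simp: bij_is_inj)
  ultimately show ?thesis
    unfolding refl_count_def by (simp add: card_image)
qed

fun rot :: "alcove \<Rightarrow> alcove" where "rot (a, b, c) = (b, c, a)"

fun flip :: "alcove \<Rightarrow> alcove" where "flip (a, b, c) = (c, b, a)"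

fun rot_node :: "node \<Rightarrow> node" where "rot_node N1 = N0" | "rot_node N2 = N1" | "rot_node N0 = N2"

fun flip_node :: "node \<Rightarrow> node" where "flip_node N1 = N0" | "flip_node N2 = N2" | "flip_node N0 = N1"

lemma symmetry_rot: "symmetry rot rot_node"
proof -
  have "bij rot"
    by (rule bij_betw_byWitness[where f' = "rot \<circ> rot"]) auto
  moreover have "rot_node (rot_node (rot_node i)) = i" for i
    by (cases i) simp_all
  then have "bij rot_node"
    by (intro bij_betw_byWitness[where f' = "rot_node \<circ> rot_node"]) auto
  moreover have "alen (rot x) = alen x" for x
    by (cases x) (simp add: ac_simps)
  moreover have "rot (reflect i m x) = reflect (rot_node i) m (rot x)" for i m x
    by (cases x; cases i) simp_all
  ultimately show ?thesis by (simp add: symmetry_def)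
qed

lemma symmetry_flip: "symmetry flip flip_node"
proof -
  have "bij flip"
    by (rule bij_betw_byWitness[where f' = flip]) auto
  moreover have "flip_node (flip_node i) = i" for i
    by (cases i) simp_all
  then have "bij flip_node"
    by (intro bij_betw_byWitness[where f' = flip_node]) auto
  moreover have "alen (flip x) = alen x" for x
    by (cases x) (simp add: ac_simps)
  moreover have "flip (reflect i m x) = reflect (flip_node i) m (flip x)" for i m x
    by (cases x; cases i) simp_all
  ultimately show ?thesis by (simp add: symmetry_def)
qed

lemma below_rot: "rot x \<in> below (rot w) \<longleftrightarrow> x \<in> below w"
  by (rule symmetry_below[OF symmetry_rot])

lemma below_origin: "below (0, 0, 0) = {(0, 0, 0)}"
proof -
  have "x = (0, 0, 0)" if "up\<^sup>*\<^sup>* x (0, 0, 0)" for x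
    using that by (induction rule: converse_rtranclp_induct) (auto simp: up_def)
  then show ?thesis by (auto simp: below_def)
qed

section \<open>Explicit Bruhat intervals\<close>

lemma region_cong:
  "l1 = l1' \<Longrightarrow> l2 = l2' \<Longrightarrow> l3 = l3' \<Longrightarrow> u1 = u1' \<Longrightarrow> u2 = u2' \<Longrightarrow> u3 = u3' \<Longrightarrow>
    region l1 l2 l3 u1 u2 u3 = region l1' l2' l3' u1' u2' u3'"
  by simp

text \<open>Stripping off the simple reflection \<open>N1\<close> leaves a rotated shorter spiral,
  so the even and odd cases feed each other. The differences sum to 0, so lower bounds near -k force
  upper bounds near 2 * k: the hexagon is close to a triangle.\<close>

lemma below_spiral:
  fixes k :: int
  assumes "1 \<le> k"
  shows "below (- k, 0, k) = region (- k) (1 - k) (- k) (2 * k - 2) (2 * k) (2 * k - 1)"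
    and "below (- k - 1, 0, k) = region (- k) (- k) (- k - 1) (2 * k - 1) (2 * k + 1) (2 * k)"
proof -
  \<comment> \<open>At n = 0 the even formula would describe the empty set, and the bound 2 * n - 1
    would exclude the top alcove of the odd one; the \<open>if\<close> and the \<open>max\<close>
    repair this.\<close>
  have odd: "below (- int n - 1, 0, int n) = region (- int n) (- int n) (- int n - 1) (max 0 (2 * int n - 1)) (2 * int n + 1) (2 * int n)"
    if "below (- int n, 0, int n) = (if n = 0 then {(0, 0, 0)} else
      region (- int n) (1 - int n) (- int n) (2 * int n - 2) (2 * int n) (2 * int n - 1))" for n
  proof (rule below_eqI[where i = N1])
    fix x assume x: "x \<in> region (- int n) (- int n) (- int n - 1) (max 0 (2 * int n - 1)) (2 * int n + 1) (2 * int n)"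
    have *: "y \<in> below (reflect N1 0 (- int n - 1, 0, int n)) \<longleftrightarrow> rot y \<in> below (- int n, 0, int n)" for y
      using below_rot[of y "reflect N1 0 (- int n - 1, 0, int n)"] by simp
    obtain a b c where abc: "x = (a, b, c)" by (cases x)
    show "x \<in> below (reflect N1 0 (- int n - 1, 0, int n)) \<or>
        reflect N1 0 x \<in> below (reflect N1 0 (- int n - 1, 0, int n))"
      unfolding * that using x unfolding abc
      by (cases "n = 0"; cases "0 \<le> a") (simp_all add: region_def alcoves_def, (smt (z3))+)
  next
    fix x y assume "up x y" "y \<in> region (- int n) (- int n) (- int n - 1) (max 0 (2 * int n - 1)) (2 * int n + 1) (2 * int n)"
    then show "x \<in> region (- int n) (- int n) (- int n - 1) (max 0 (2 * int n - 1)) (2 * int n + 1) (2 * int n)"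
      by (rule region_down_closed) auto
  qed (auto simp: region_def alcoves_def alen_less_iff simp del: alen.simps)
  have even: "below (- int n - 1, 0, int n + 1) = region (- int n - 1) (- int n) (- int n - 1) (2 * int n) (2 * int n + 2) (2 * int n + 1)"
    if "below (- int n - 1, 0, int n) = region (- int n) (- int n) (- int n - 1) (max 0 (2 * int n - 1)) (2 * int n + 1) (2 * int n)" for n
  proof (rule below_eqI[where i = N1])
    fix x assume x: "x \<in> region (- int n - 1) (- int n) (- int n - 1) (2 * int n) (2 * int n + 2) (2 * int n + 1)"
    have *: "y \<in> below (reflect N1 0 (- int n - 1, 0, int n + 1)) \<longleftrightarrow> rot y \<in> below (- int n - 1, 0, int n)" for y
      using below_rot[of y "reflect N1 0 (- int n - 1, 0, int n + 1)"] by simp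
    obtain a b c where abc: "x = (a, b, c)" by (cases x)
    show "x \<in> below (reflect N1 0 (- int n - 1, 0, int n + 1)) \<or>
        reflect N1 0 x \<in> below (reflect N1 0 (- int n - 1, 0, int n + 1))"
    proof (cases "n = 0")
      case True
      then show ?thesis unfolding * that using x unfolding abc by (simp add: region_def alcoves_def) presburger
    next
      case False
      then have "1 \<le> int n" by simp
      then show ?thesis unfolding * that using x unfolding abc
        by (cases "0 \<le> a", intro disjI1, simp add: region_def alcoves_def, smt (verit),
          intro disjI2, simp add: region_def alcoves_def, smt (verit))
    qed
  next
    fix x y assume "up x y" "y \<in> region (- int n - 1) (- int n) (- int n - 1) (2 * int n) (2 * int n + 2) (2 * int n + 1)"
    then show "x \<in> region (- int n - 1) (- int n) (- int n - 1) (2 * int n) (2 * int n + 2) (2 * int n + 1)"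
      by (rule region_down_closed) auto
  qed (auto simp: region_def alcoves_def alen_less_iff simp del: alen.simps)
  have all: "below (- int n, 0, int n) = (if n = 0 then {(0, 0, 0)} else
      region (- int n) (1 - int n) (- int n) (2 * int n - 2) (2 * int n) (2 * int n - 1))" for n
  proof (induction n)
    case (Suc n)
    have "below (- int (Suc n), 0, int (Suc n)) = below (- int n - 1, 0, int n + 1)"
      by (intro arg_cong[where f = below]) simp
    also have "\<dots> = region (- int (Suc n)) (1 - int (Suc n)) (- int (Suc n))
        (2 * int (Suc n) - 2) (2 * int (Suc n)) (2 * int (Suc n) - 1)"
      unfolding even[OF odd[OF Suc]] by (intro region_cong) simp_all
    finally show ?case by simp
  qed (simp add: below_origin)
  obtain n where k: "k = int n"
    using assms zero_le_imp_eq_int[of k] by auto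
  with assms have n: "n \<noteq> 0" by auto
  show "below (- k, 0, k) = region (- k) (1 - k) (- k) (2 * k - 2) (2 * k) (2 * k - 1)"
    using all[of n] n unfolding k by simp
  show "below (- k - 1, 0, k) = region (- k) (- k) (- k - 1) (2 * k - 1) (2 * k + 1) (2 * k)"
    using odd[OF all, of n] n unfolding k by simp
qed

text \<open>Stripping a descent alternates between the two shapes, so they share one induction. For
  B > 0, \<open>N1\<close> followed by \<open>rot\<close> makes the middle coordinate negative. For
  B < 0, \<open>N2\<close> makes it -1 - B, which is positive unless B = -1, where a spiral is
  reached.\<close>

lemma below_hexagon:
  assumes "(A, B, C) \<in> alcoves" "A < 0" "0 < C"
  shows "(0 < B \<longrightarrow> below (A, B, C) =
      region (A - B + 2) (A - B + 1) (A - B) (C - A - 2) (C - A) (C - A - 1)) \<and>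
    (B < 0 \<longrightarrow> below (A, B, C) =
      region (B - C) (B - C + 2) (B - C + 1) (C - A - 2) (C - A) (C - A - 1))"
  using assms
proof (induction "alen (A, B, C)" arbitrary: A B C rule: less_induct)
  case less
  have sum: "A + B + C = 0 \<or> A + B + C = -1"
    using less.prems(1) by (simp add: alcoves_def)
  show ?case
  proof (intro conjI impI)
    assume B: "0 < B"
    let ?X = "region (A - B + 2) (A - B + 1) (A - B) (C - A - 2) (C - A) (C - A - 1)"
    have lt: "alen (reflect N1 0 (A, B, C)) < alen (A, B, C)"
      using less.prems by (simp add: alen_less_iff del: alen.simps)
    then have lt': "alen (- C, - B, - 1 - A) < alen (A, B, C)"
      by (simp add: ac_simps)
    have IH: "below (- C, - B, - 1 - A) =
        region (A - B + 1) (A - B + 3) (A - B + 2) (C - A - 3) (C - A - 1) (C - A - 2)"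
      by (rule HOL.trans[OF mp[OF conjunct2[OF less.hyps]] region_cong])
        (use lt' less.prems sum B in \<open>auto simp: alcoves_def simp del: alen.simps\<close>)
    show "below (A, B, C) = ?X"
    proof (rule below_eqI[OF _ _ _ lt])
      fix x assume x: "x \<in> ?X"
      have *: "y \<in> below (reflect N1 0 (A, B, C)) \<longleftrightarrow> rot y \<in> below (- C, - B, - 1 - A)" for y
        using below_rot[of y "reflect N1 0 (A, B, C)"] by simp
      obtain a b c where abc: "x = (a, b, c)" by (cases x)
      show "x \<in> below (reflect N1 0 (A, B, C)) \<or> reflect N1 0 x \<in> below (reflect N1 0 (A, B, C))"
        unfolding * IH using x sum B less.prems(2,3) unfolding abc
        by (cases "0 \<le> a") (simp_all add: region_def alcoves_def, (smt (verit))+)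
    next
      fix x y assume "up x y" "y \<in> ?X"
      then show "x \<in> ?X" by (rule region_down_closed) auto
    qed (use less.prems sum B in \<open>auto simp: region_def alcoves_def\<close>)
  next
    assume B: "B < 0"
    let ?X = "region (B - C) (B - C + 2) (B - C + 1) (C - A - 2) (C - A) (C - A - 1)"
    have lt: "alen (reflect N2 0 (A, B, C)) < alen (A, B, C)"
      using B by (simp add: alen_less_iff del: alen.simps)
    have IH: "below (- C, - 1 - B, - A) =
        region (B - C + 3) (B - C + 2) (B - C + 1) (C - A - 2) (C - A) (C - A - 1)"
      if "B \<noteq> - 1"
      by (rule HOL.trans[OF mp[OF conjunct1[OF less.hyps]] region_cong])
        (use lt less.prems sum B that in \<open>auto simp: alcoves_def simp del: alen.simps\<close>)
    \<comment> \<open>At B = -1 the coordinate sum decides whether the spiral has even or odd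
      length.\<close>
    have IH1: "below (- C, - 1 - B, - A) =
        region (B - C + 1) (B - C + 2) (B - C + 1) (C - A - 2) (C - A) (C - A - 1)"
      if "B = - 1" "A + B + C = - 1"
    proof -
      have "below (- C, - 1 - B, - A) = below (- C, 0, C)"
        using that by (intro arg_cong[where f = below]) auto
      also have "\<dots> = region (B - C + 1) (B - C + 2) (B - C + 1) (C - A - 2) (C - A) (C - A - 1)"
        by (rule HOL.trans[OF below_spiral(1) region_cong]) (use that less.prems(3) in auto)
      finally show ?thesis .
    qed
    have IH2: "below (- C, - 1 - B, - A) =
        region (B - C + 2) (B - C + 2) (B - C + 1) (C - A - 2) (C - A) (C - A - 1)"
      if "B = - 1" "A + B + C = 0"
    proof -
      have "below (- C, - 1 - B, - A) = below (- (- A) - 1, 0, - A)"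
        using that by (intro arg_cong[where f = below]) auto
      also have "\<dots> = region (B - C + 2) (B - C + 2) (B - C + 1) (C - A - 2) (C - A) (C - A - 1)"
        by (rule HOL.trans[OF below_spiral(2)[of "- A"] region_cong]) (use that less.prems(2) in auto)
      finally show ?thesis .
    qed
    show "below (A, B, C) = ?X"
    proof (rule below_eqI[OF _ _ _ lt])
      fix x assume x: "x \<in> ?X"
      obtain a b c where abc: "x = (a, b, c)" by (cases x)
      consider "B \<noteq> - 1" | "B = - 1" "A + B + C = - 1" | "B = - 1" "A + B + C = 0"
        using sum by blast
      then have "x \<in> below (- C, - 1 - B, - A) \<or> reflect N2 0 x \<in> below (- C, - 1 - B, - A)"
      proof cases
        case 1
        then show ?thesis
          unfolding IH[OF 1] using x sum B less.prems(2,3) unfolding abc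
          by (cases "0 \<le> b") (simp_all add: region_def alcoves_def, (smt (verit))+)
      next
        case 2
        then show ?thesis
          unfolding IH1[OF 2] using x sum B less.prems(2,3) unfolding abc
          by (cases "0 \<le> b") (simp_all add: region_def alcoves_def, (smt (verit))+)
      next
        case 3
        then show ?thesis
          unfolding IH2[OF 3] using x sum B less.prems(2,3) unfolding abc
          by (cases "0 \<le> b") (simp_all add: region_def alcoves_def, (smt (verit))+)
      qed
      then show "x \<in> below (reflect N2 0 (A, B, C)) \<or> reflect N2 0 x \<in> below (reflect N2 0 (A, B, C))"
        by simp
    next
      fix x y assume "up x y" "y \<in> ?X"
      then show "x \<in> ?X" by (rule region_down_closed) auto
    qed (use less.prems sum B in \<open>auto simp: region_def alcoves_def\<close>)
  qed
qed

section \<open>Counting reflections\<close>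

lemma UNIV_node: "UNIV = {N0, N1, N2}"
  using node.exhaust by auto

text \<open>A reflection of direction \<open>N1\<close> keeps b - c, so only the other four bounds
  restrict m, each by an inequality for 3 * m. The solutions form an interval of integers;
  \<open>max 0\<close> covers an empty one.\<close>

lemma chord:
  assumes "(a, b, c) \<in> region l1 l2 l3 u1 u2 u3"
  defines "X \<equiv> {m. reflect N1 m (a, b, c) \<in> region l1 l2 l3 u1 u2 u3}"
  shows "finite X"
    and "int (card X) = max 0 (min ((a - b + 1 - l2) div 3) ((u3 + 1 - (c - a)) div 3) +
      min ((u2 - 1 - (a - b)) div 3) ((c - a - 1 - l3) div 3) + 1)"
proof -
  have "X = {- min ((u2 - 1 - (a - b)) div 3) ((c - a - 1 - l3) div 3) ..
      min ((a - b + 1 - l2) div 3) ((u3 + 1 - (c - a)) div 3)}"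
  proof (intro Set.set_eqI)
    fix m
    have div3: "k \<le> z div 3 \<longleftrightarrow> 3 * k \<le> z" for k z :: int
      by presburger
    have "m \<in> X \<longleftrightarrow> (3 * m \<le> a - b + 1 - l2 \<and> 3 * m \<le> u3 + 1 - (c - a)) \<and>
        (3 * (- m) \<le> u2 - 1 - (a - b) \<and> 3 * (- m) \<le> c - a - 1 - l3)"
    proof -
      have e: "(2 * m - 1 - a) + (- c - m) + (- b - m) = - 1 - (a + b + c)"
        "(- c - m) - (- b - m) = b - c" "(- b - m) - (2 * m - 1 - a) = a - b + 1 - 3 * m"
        "(2 * m - 1 - a) - (- c - m) = c - a - 1 + 3 * m"
        by simp_all
      have "a + b + c = 0 \<or> a + b + c = - 1" "l1 \<le> b - c" "b - c \<le> u1"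
        using assms(1) by (auto simp: region_def alcoves_def)
      then have "m \<in> X \<longleftrightarrow> l2 \<le> a - b + 1 - 3 * m \<and> a - b + 1 - 3 * m \<le> u2 \<and>
          l3 \<le> c - a - 1 + 3 * m \<and> c - a - 1 + 3 * m \<le> u3"
        by (simp only: X_def region_def alcoves_def mem_Collect_eq reflect.simps prod.case e) auto
      moreover have "l2 \<le> a - b + 1 - 3 * m \<longleftrightarrow> 3 * m \<le> a - b + 1 - l2"
        "a - b + 1 - 3 * m \<le> u2 \<longleftrightarrow> 3 * (- m) \<le> u2 - 1 - (a - b)"
        "l3 \<le> c - a - 1 + 3 * m \<longleftrightarrow> 3 * (- m) \<le> c - a - 1 - l3"
        "c - a - 1 + 3 * m \<le> u3 \<longleftrightarrow> 3 * m \<le> u3 + 1 - (c - a)"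
        by linarith+
      ultimately show ?thesis by blast
    qed
    then show "m \<in> X \<longleftrightarrow> m \<in> {- min ((u2 - 1 - (a - b)) div 3) ((c - a - 1 - l3) div 3) ..
        min ((a - b + 1 - l2) div 3) ((u3 + 1 - (c - a)) div 3)}"
      by (simp only: div3[symmetric] atLeastAtMost_iff min.bounded_iff minus_le_iff[of _ m] conj_commute)
  qed
  moreover have "int (card {- p..q}) = max 0 (q + p + 1)" for p q :: int
    by simp
  ultimately show "finite X"
    "int (card X) = max 0 (min ((a - b + 1 - l2) div 3) ((u3 + 1 - (c - a)) div 3) +
      min ((u2 - 1 - (a - b)) div 3) ((c - a - 1 - l3) div 3) + 1)"
    by (simp_all only: finite_atLeastAtMost_int)
qed

lemma region_rot: "rot x \<in> region l2 l3 l1 u2 u3 u1 \<longleftrightarrow> x \<in> region l1 l2 l3 u1 u2 u3"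
  by (cases x) (auto simp: region_def alcoves_def)

text \<open>One or two applications of \<open>rot\<close> turn the chords of directions
  \<open>N2\<close> and \<open>N0\<close> into chords of direction \<open>N1\<close>.\<close>

lemma refl_count_region:
  assumes "below w = region l1 l2 l3 u1 u2 u3" "(a, b, c) \<in> below w"
  shows "int (refl_count w (a, b, c)) =
    max 0 (min ((a - b + 1 - l2) div 3) ((u3 + 1 - (c - a)) div 3) +
      min ((u2 - 1 - (a - b)) div 3) ((c - a - 1 - l3) div 3) + 1) +
    max 0 (min ((b - c + 1 - l3) div 3) ((u1 + 1 - (a - b)) div 3) +
      min ((u3 - 1 - (b - c)) div 3) ((a - b - 1 - l1) div 3) + 1) +
    max 0 (min ((c - a + 1 - l1) div 3) ((u2 + 1 - (b - c)) div 3) +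
      min ((u1 - 1 - (c - a)) div 3) ((b - c - 1 - l2) div 3) + 1)"
proof -
  define X where "X i = {m. reflect i m (a, b, c) \<in> below w}" for i
  have rot: "rot (reflect N2 m (a, b, c)) = reflect N1 m (b, c, a)"
    "rot (rot (reflect N0 m (a, b, c))) = reflect N1 m (c, a, b)" for m
    by simp_all
  have X: "X N1 = {m. reflect N1 m (a, b, c) \<in> region l1 l2 l3 u1 u2 u3}"
    "X N2 = {m. reflect N1 m (b, c, a) \<in> region l2 l3 l1 u2 u3 u1}"
    "X N0 = {m. reflect N1 m (c, a, b) \<in> region l3 l1 l2 u3 u1 u2}"
    unfolding X_def assms(1) rot[symmetric] by (simp_all only: region_rot)
  have x: "(a, b, c) \<in> region l1 l2 l3 u1 u2 u3"
    using assms by simp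
  then have y: "(b, c, a) \<in> region l2 l3 l1 u2 u3 u1"
    using region_rot[of "(a, b, c)"] by simp
  then have z: "(c, a, b) \<in> region l3 l1 l2 u3 u1 u2"
    using region_rot[of "(b, c, a)"] by simp
  have fin: "finite (X i)" for i
    using chord(1)[OF x] chord(1)[OF y] chord(1)[OF z] by (cases i) (simp_all only: X)
  have "refl_count w (a, b, c) = card (Sigma UNIV X)"
    unfolding refl_count_def X_def by (intro arg_cong[where f = card]) auto
  also have "\<dots> = card (X N1) + card (X N2) + card (X N0)"
    using fin by (subst card_SigmaI) (auto simp: UNIV_node)
  finally show ?thesis
    unfolding X by (simp only: of_nat_add chord(2)[OF x] chord(2)[OF y] chord(2)[OF z])
qed

text \<open>Apart from the smallest ones, all Bruhat intervals have this shape up to symmetry, with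
  \<open>L = U - 3 * s + t\<close> and \<open>2 * s - t\<close> the length of the top element.\<close>

abbreviation hexagon :: "int \<Rightarrow> int \<Rightarrow> int \<Rightarrow> int \<Rightarrow> int \<Rightarrow> int \<Rightarrow> int \<Rightarrow> int \<Rightarrow> alcove set" where
  "hexagon L U x1 x2 x3 y1 y2 y3 \<equiv> region (L + x1) (L + x2) (L + x3) (U - y1) (U - y2) (U - y3)"

text \<open>This is 0 <= 3 * q + e divided by 3: once the remainders are known,
  \<open>e div 3\<close> is a numeral and a linear condition on the quotient is left.\<close>

definition gap :: "int \<Rightarrow> int \<Rightarrow> bool" where
  "gap q e \<longleftrightarrow> 0 \<le> q + e div 3"

text \<open>These are the three chord lengths of \<open>refl_count_region\<close> for the upper
  offsets 2, 0, 1, with the quotients pulled out of the divisions.\<close>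

definition chord_sum :: "int \<Rightarrow> int \<Rightarrow> int \<Rightarrow> int \<Rightarrow> int \<Rightarrow> int \<Rightarrow> int \<Rightarrow> int \<Rightarrow> int \<Rightarrow> int \<Rightarrow> int" where
  "chord_sum p u v s r g t x1 x2 x3 =
    max 0 (min (s - u + (1 - r - g - t - x2) div 3) (p + r div 3) +
      min (u + (r + g - 1) div 3) (s - p + (- r - 1 - t - x3) div 3) + 1) +
    max 0 (min (s - v + (1 - r + g - t - x3) div 3) (u + (r + g - 1) div 3) +
      min (v + (r - g - 2) div 3) (s - u + (- r - g - 1 - t - x1) div 3) + 1) +
    max 0 (min (s - p + (1 - r - t - x1) div 3) (v + (r - g + 1) div 3) +
      min (p + (r - 3) div 3) (s - v + (g - r - 1 - t - x2) div 3) + 1)"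

text \<open>The coordinates \<open>v\<close>, \<open>p\<close>, \<open>u\<close> measure the distances to the three upper sides of a hexagon in
  units of 3, with remainders determined by \<open>r\<close> and \<open>g\<close>; they make all divisions exact.\<close>

lemma alcove_coords:
  assumes "x \<in> alcoves"
  obtains p u v r g :: int where "x = (p - u, g - v + u, v - p)" "U = p + u + v + r"
    "r = 0 \<or> r = 1 \<or> r = 2" "g = 0 \<or> g = - 1"
proof -
  obtain a b c where x: "x = (a, b, c)" by (cases x)
  \<comment> \<open>The distance 3 * p + r to the side c - a = U is divided with remainder; a, c and
    the coordinate sum g then force u = p - a and v = p + c.\<close>
  define p r where "p = (U - (c - a)) div 3" and "r = (U - (c - a)) mod 3"
  have "U - (c - a) = 3 * p + r" by (simp add: p_def r_def)
  moreover have "r = 0 \<or> r = 1 \<or> r = 2" unfolding r_def by presburger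
  ultimately show ?thesis
    using assms x by (intro that[of p "p - a" "a + b + c" "p + c" r]) (auto simp: alcoves_def)
qed

lemma div3_add: "(3 * q + e) div 3 = q + e div 3" for q e :: int
  by simp

text \<open>The distances from the upper bound U are 3 * v + r - g, 3 * p + r and 3 * u + r + g.
  Since U - L = 3 * s - t, those from L have the quotients s - v, s - p and s - u.\<close>

lemma hexagon_iff:
  assumes "U = p + u + v + r" "L = U - 3 * s + t" "g = 0 \<or> g = - 1"
  shows "(p - u, g - v + u, v - p) \<in> hexagon L U x1 x2 x3 y1 y2 y3 \<longleftrightarrow>
    gap (s - v) (g - r - t - x1) \<and> gap v (r - g - y1) \<and>
    gap (s - p) (- r - t - x2) \<and> gap p (r - y2) \<and>
    gap (s - u) (- r - g - t - x3) \<and> gap u (r + g - y3)"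
proof -
  have gap: "gap q e \<longleftrightarrow> 0 \<le> 3 * q + e" for q e
    unfolding gap_def by presburger
  show ?thesis
    using assms by (auto simp: region_def alcoves_def gap)
qed

lemma refl_count_hexagon:
  assumes "below w = hexagon L U x1 x2 x3 2 0 1" "(p - u, g - v + u, v - p) \<in> below w"
    and "U = p + u + v + r" "L = U - 3 * s + t"
  shows "int (refl_count w (p - u, g - v + u, v - p)) = chord_sum p u v s r g t x1 x2 x3"
proof -
  have "p - u - (g - v + u) + 1 - (L + x2) = 3 * (s - u) + (1 - r - g - t - x2)"
    "U - 1 + 1 - (v - p - (p - u)) = 3 * p + r"
    "U - 0 - 1 - (p - u - (g - v + u)) = 3 * u + (r + g - 1)"
    "v - p - (p - u) - 1 - (L + x3) = 3 * (s - p) + (- r - 1 - t - x3)"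
    "g - v + u - (v - p) + 1 - (L + x3) = 3 * (s - v) + (1 - r + g - t - x3)"
    "U - 2 + 1 - (p - u - (g - v + u)) = 3 * u + (r + g - 1)"
    "U - 1 - 1 - (g - v + u - (v - p)) = 3 * v + (r - g - 2)"
    "p - u - (g - v + u) - 1 - (L + x1) = 3 * (s - u) + (- r - g - 1 - t - x1)"
    "v - p - (p - u) + 1 - (L + x1) = 3 * (s - p) + (1 - r - t - x1)"
    "U - 0 + 1 - (g - v + u - (v - p)) = 3 * v + (r - g + 1)"
    "U - 2 - 1 - (v - p - (p - u)) = 3 * p + (r - 3)"
    "g - v + u - (v - p) - 1 - (L + x2) = 3 * (s - v) + (g - r - 1 - t - x2)"
    using assms(3,4) by auto
  with refl_count_region[OF assms(1,2)] show ?thesis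
    by (simp only: div3_add chord_sum_def)
qed

text \<open>Up to symmetry, the top element has one negative coordinate, two negative coordinates, or a
  coordinate 0; in the last case it is a spiral \<open>\<dots>s\<^sub>1s\<^sub>2s\<^sub>0s\<^sub>1s\<^sub>2s\<^sub>0\<close>. Even and odd refer to its length.\<close>

lemma refl_count_one_neg_even:
  assumes "below w = hexagon L U 2 1 0 2 0 1" "x \<in> below w" "L = U - 3 * s" "s + 1 \<le> U" "U \<le> 2 * s - 1"
  shows "2 * s < int (refl_count w x) \<longleftrightarrow> x \<in> hexagon L U 2 4 3 2 3 4"
proof -
  have "x \<in> alcoves"
    using assms(1,2) by (auto simp: region_def)
  then obtain p u v r g where x: "x = (p - u, g - v + u, v - p)" and U: "U = p + u + v + r"
    and r: "r = 0 \<or> r = 1 \<or> r = 2" and g: "g = 0 \<or> g = - 1"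
    by (rule alcove_coords)
  have L: "L = U - 3 * s + 0" using assms(3) by simp
  have "x \<in> hexagon L U 2 1 0 2 0 1" using assms(1,2) by simp
  then show ?thesis
    unfolding x hexagon_iff[OF U L g] refl_count_hexagon[OF assms(1) assms(2)[unfolded x] U L]
    \<comment> \<open>The six cases for (r, g) turn all divisions by 3 into numerals; linear
      arithmetic with minima and maxima remains.\<close>
    using r g U assms(4,5) by (elim disjE) (simp add: chord_sum_def gap_def; smt (verit))+
qed

text \<open>One hexagon lies 2 inside all six sides of the interval. The other keeps the two sides
  in b - c and moves the remaining four in by 3; it is the one that occurs for even length.\<close>

lemma refl_count_one_neg_odd:
  assumes "below w = hexagon L U 2 1 0 2 0 1" "x \<in> below w" "L = U - 3 * s + 1" "s + 1 \<le> U" "U \<le> 2 * s - 2"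
  shows "2 * s - 1 < int (refl_count w x) \<longleftrightarrow> x \<in> hexagon L U 4 3 2 4 2 3 \<union> hexagon L U 2 4 3 2 3 4"
proof -
  have "x \<in> alcoves"
    using assms(1,2) by (auto simp: region_def)
  then obtain p u v r g where x: "x = (p - u, g - v + u, v - p)" and U: "U = p + u + v + r"
    and r: "r = 0 \<or> r = 1 \<or> r = 2" and g: "g = 0 \<or> g = - 1"
    by (rule alcove_coords)
  have "x \<in> hexagon L U 2 1 0 2 0 1" using assms(1,2) by simp
  then show ?thesis
    unfolding x Un_iff hexagon_iff[OF U assms(3) g] refl_count_hexagon[OF assms(1) assms(2)[unfolded x] U assms(3)]
    using r g U assms(4,5) by (elim disjE) (simp add: chord_sum_def gap_def; smt (verit))+
qed

text \<open>Compared with the interval, all six sides move in by 2.\<close>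

lemma refl_count_two_neg_even:
  assumes "below w = hexagon L U 0 2 1 2 0 1" "x \<in> below w" "L = U - 3 * s" "s + 1 \<le> U" "U \<le> 2 * s - 1"
  shows "2 * s < int (refl_count w x) \<longleftrightarrow> x \<in> hexagon L U 2 4 3 4 2 3"
proof -
  have "x \<in> alcoves"
    using assms(1,2) by (auto simp: region_def)
  then obtain p u v r g where x: "x = (p - u, g - v + u, v - p)" and U: "U = p + u + v + r"
    and r: "r = 0 \<or> r = 1 \<or> r = 2" and g: "g = 0 \<or> g = - 1"
    by (rule alcove_coords)
  have L: "L = U - 3 * s + 0" using assms(3) by simp
  have "x \<in> hexagon L U 0 2 1 2 0 1" using assms(1,2) by simp
  then show ?thesis
    unfolding x hexagon_iff[OF U L g] refl_count_hexagon[OF assms(1) assms(2)[unfolded x] U L]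
    using r g U assms(4,5) by (elim disjE) (simp add: chord_sum_def gap_def; smt (verit))+
qed

text \<open>All six sides move in by 3. With s = C and U = C - A for the top element (A, B, C), the
  extra condition fails exactly for A = -1 or B = -1; then no alcove has positive excess.\<close>

lemma refl_count_two_neg_odd:
  assumes "below w = hexagon L U 0 2 1 2 0 1" "x \<in> below w" "L = U - 3 * s - 1" "s + 1 \<le> U" "U \<le> 2 * s"
  shows "2 * s + 1 < int (refl_count w x) \<longleftrightarrow> x \<in> hexagon L U 3 5 4 5 3 4 \<and> s + 1 < U \<and> U < 2 * s"
proof -
  have "x \<in> alcoves"
    using assms(1,2) by (auto simp: region_def)
  then obtain p u v r g where x: "x = (p - u, g - v + u, v - p)" and U: "U = p + u + v + r"
    and r: "r = 0 \<or> r = 1 \<or> r = 2" and g: "g = 0 \<or> g = - 1"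
    by (rule alcove_coords)
  have L: "L = U - 3 * s + (- 1)" using assms(3) by simp
  have "x \<in> hexagon L U 0 2 1 2 0 1" using assms(1,2) by simp
  then show ?thesis
    unfolding x hexagon_iff[OF U L g] refl_count_hexagon[OF assms(1) assms(2)[unfolded x] U L]
    using r g U assms(4,5) by (elim disjE) (simp add: chord_sum_def gap_def; smt (verit))+
qed

text \<open>Only the lower sides of the triangle move in, by 2, 1 and 1. Inside, rounding alone
  decides, and it depends on the residue of r - g.\<close>

lemma refl_count_spiral_even:
  assumes "below w = hexagon (- k) (2 * k) 0 1 0 2 0 1" "(a, b, c) \<in> below w"
  shows "2 * k < int (refl_count w (a, b, c)) \<longleftrightarrow>
    (a, b, c) \<in> hexagon (- k) (2 * k) 2 2 1 2 0 1 \<and> (2 * k - (b - c)) mod 3 = 1"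
proof -
  have "(a, b, c) \<in> alcoves"
    using assms(1,2) by (auto simp: region_def)
  then obtain p u v r g where x: "(a, b, c) = (p - u, g - v + u, v - p)" and U: "2 * k = p + u + v + r"
    and r: "r = 0 \<or> r = 1 \<or> r = 2" and g: "g = 0 \<or> g = - 1"
    by (rule alcove_coords)
  have L: "- k = 2 * k - 3 * k + 0" by simp
  have "2 * k - (b - c) = (r - g) + v * 3" using x U by simp
  then have m: "(2 * k - (b - c)) mod 3 = (r - g) mod 3" by simp
  have "(a, b, c) \<in> hexagon (- k) (2 * k) 0 1 0 2 0 1" using assms by simp
  then show ?thesis
    unfolding m unfolding x hexagon_iff[OF U L g] refl_count_hexagon[OF assms(1) assms(2)[unfolded x] U L]
    using r g U by (elim disjE) (simp add: chord_sum_def gap_def; smt (verit))+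
qed

lemma refl_count_spiral_odd:
  assumes "below w = hexagon (- k - 1) (2 * k + 1) 1 1 0 2 0 1" "(a, b, c) \<in> below w"
  shows "2 * k + 1 < int (refl_count w (a, b, c)) \<longleftrightarrow>
    (a, b, c) \<in> hexagon (- k - 1) (2 * k + 1) 2 3 2 2 0 1 \<and> (2 * k + 1 - (b - c)) mod 3 \<noteq> 1"
proof -
  have "(a, b, c) \<in> alcoves"
    using assms(1,2) by (auto simp: region_def)
  then obtain p u v r g where x: "(a, b, c) = (p - u, g - v + u, v - p)" and U: "2 * k + 1 = p + u + v + r"
    and r: "r = 0 \<or> r = 1 \<or> r = 2" and g: "g = 0 \<or> g = - 1"
    by (rule alcove_coords)
  have L: "- k - 1 = 2 * k + 1 - 3 * (k + 1) + 1" by simp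
  have "2 * k + 1 - (b - c) = (r - g) + v * 3" using x U by simp
  then have m: "(2 * k + 1 - (b - c)) mod 3 = (r - g) mod 3" by simp
  have "(a, b, c) \<in> hexagon (- k - 1) (2 * k + 1) 1 1 0 2 0 1" using assms by simp
  then show ?thesis
    unfolding m unfolding x hexagon_iff[OF U L g] refl_count_hexagon[OF assms(1) assms(2)[unfolded x] U L]
    using r g U by (elim disjE) (simp add: chord_sum_def gap_def; smt (verit))+
qed

section \<open>The lookup property for alcoves\<close>

text \<open>The inequality \<open>alen w < refl_count w y\<close> expresses q > 0 at y.\<close>

definition lookup_property :: "alcove \<Rightarrow> bool" where
  "lookup_property w \<longleftrightarrow> (\<forall>x y. x \<in> below y \<longrightarrow> y \<in> below w \<longrightarrow> alen w < refl_count w y \<longrightarrow>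
     alen w < refl_count w x \<or> (\<exists>z. up x z \<and> z \<in> below w \<and> alen w < refl_count w z))"

text \<open>The set \<open>V\<close> is down-closed and contains all alcoves of positive excess in
  the interval, hence everything below them; so only alcoves in \<open>V\<close> need a
  witness.\<close>

lemma lookupI:
  assumes pos: "\<And>y. y \<in> below w \<Longrightarrow> alen w < refl_count w y \<Longrightarrow> y \<in> V"
    and down: "\<And>x y. up x y \<Longrightarrow> y \<in> V \<Longrightarrow> x \<in> V"
    and V: "\<And>x. x \<in> below w \<Longrightarrow> x \<in> V \<Longrightarrow>
      alen w < refl_count w x \<or> (\<exists>z. up x z \<and> z \<in> below w \<and> alen w < refl_count w z)"
  shows "lookup_property w"
  unfolding lookup_property_def
proof (intro allI impI)
  fix x y assume "x \<in> below y" and y: "y \<in> below w" "alen w < refl_count w y"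
  then have "up\<^sup>*\<^sup>* x y" by (simp add: below_def)
  then have "x \<in> V"
    by (induction rule: converse_rtranclp_induct) (use pos y down in blast)+
  moreover have "x \<in> below w"
    using \<open>x \<in> below y\<close> y(1) by (rule below_trans)
  ultimately show "alen w < refl_count w x \<or> (\<exists>z. up x z \<and> z \<in> below w \<and> alen w < refl_count w z)"
    by (rule V[rotated])
qed

lemma symmetry_lookup:
  assumes "symmetry f p" "lookup_property w"
  shows "lookup_property (f w)"
  unfolding lookup_property_def
proof (intro allI impI)
  fix x y assume xy: "x \<in> below y" "y \<in> below (f w)" "alen (f w) < refl_count (f w) y"
  have surj: "f (inv_into UNIV f x) = x" for x
    using symmetryD(1)[OF assms(1)] by (simp add: bij_is_surj surj_f_inv_f)
  obtain x' y' where [simp]: "x = f x'" "y = f y'"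
    using surj by metis
  note sym = symmetry_below[OF assms(1)] symmetry_refl_count[OF assms(1)] symmetryD(3)[OF assms(1)]
  have "alen w < refl_count w x' \<or> (\<exists>z. up x' z \<and> z \<in> below w \<and> alen w < refl_count w z)"
    using assms(2) xy unfolding lookup_property_def by (simp only: \<open>x = f x'\<close> \<open>y = f y'\<close> sym)
  then show "alen (f w) < refl_count (f w) x \<or> (\<exists>z. up x z \<and> z \<in> below (f w) \<and> alen (f w) < refl_count (f w) z)"
  proof
    assume "\<exists>z. up x' z \<and> z \<in> below w \<and> alen w < refl_count w z"
    then obtain z where "up x' z" "z \<in> below w" "alen w < refl_count w z" by blast
    then have "up x (f z)" "f z \<in> below (f w)" "alen (f w) < refl_count (f w) (f z)"
      using symmetry_up[OF assms(1)] by (simp_all only: sym \<open>x = f x'\<close>)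
    then show ?thesis by blast
  qed (simp only: sym \<open>x = f x'\<close> simp_thms)
qed

text \<open>In each case the alcoves of positive excess are cut out of the interval by a down-closed
  set, so x itself is the witness.\<close>

lemma lookup_hexagon:
  assumes w: "(A, B, C) \<in> alcoves" "A < 0" "0 < C" "B \<noteq> 0"
  shows "lookup_property (A, B, C)"
proof (cases "0 < B")
  case True
  define L U where "L = A - B" and "U = C - A"
  have below: "below (A, B, C) = hexagon L U 2 1 0 2 0 1"
    using below_hexagon[OF w(1-3)] True by (simp add: L_def U_def)
  consider (even) "A + B + C = 0" | (odd) "A + B + C = - 1"
    using w(1) by (auto simp: alcoves_def)
  then show ?thesis
  proof cases
    case even
    have len: "int (alen (A, B, C)) = 2 * (- A)"
      using even True w by simp
    have refl_count: "alen (A, B, C) < refl_count (A, B, C) x \<longleftrightarrow> x \<in> hexagon L U 2 4 3 2 3 4"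
      if "x \<in> below (A, B, C)" for x
      unfolding of_nat_less_iff[where 'a = int, symmetric] len
      by (rule refl_count_one_neg_even[OF below that]) (use even True w in \<open>auto simp: L_def U_def\<close>)
    show ?thesis
    proof (rule lookupI[where V = "hexagon L U 2 4 3 2 3 4"])
      fix x y assume "up x y" "y \<in> hexagon L U 2 4 3 2 3 4"
      then show "x \<in> hexagon L U 2 4 3 2 3 4" by (rule region_down_closed) simp_all
    qed (use refl_count in blast)+
  next
    case odd
    have len: "int (alen (A, B, C)) = 2 * (- A) - 1"
      using odd True w by simp
    let ?V = "hexagon L U 4 3 2 4 2 3 \<union> hexagon L U 2 4 3 2 3 4"
    have refl_count: "alen (A, B, C) < refl_count (A, B, C) x \<longleftrightarrow> x \<in> ?V"
      if "x \<in> below (A, B, C)" for x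
      unfolding of_nat_less_iff[where 'a = int, symmetric] len
      by (rule refl_count_one_neg_odd[OF below that]) (use odd True w in \<open>auto simp: L_def U_def\<close>)
    show ?thesis
    proof (rule lookupI[where V = ?V])
      fix x y assume up: "up x y" and "y \<in> ?V"
      from this(2) show "x \<in> ?V"
      proof
        assume "y \<in> hexagon L U 4 3 2 4 2 3"
        with up have "x \<in> hexagon L U 4 3 2 4 2 3" by (rule region_down_closed) simp_all
        then show ?thesis ..
      next
        assume "y \<in> hexagon L U 2 4 3 2 3 4"
        with up have "x \<in> hexagon L U 2 4 3 2 3 4" by (rule region_down_closed) simp_all
        then show ?thesis ..
      qed
    qed (use refl_count in blast)+
  qed
next
  case False
  define L U where "L = B - C" and "U = C - A"
  have below: "below (A, B, C) = hexagon L U 0 2 1 2 0 1"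
    using below_hexagon[OF w(1-3)] False w(4) by (simp add: L_def U_def)
  consider (even) "A + B + C = 0" | (odd) "A + B + C = - 1"
    using w(1) by (auto simp: alcoves_def)
  then show ?thesis
  proof cases
    case even
    have len: "int (alen (A, B, C)) = 2 * C"
      using even False w by simp
    have refl_count: "alen (A, B, C) < refl_count (A, B, C) x \<longleftrightarrow> x \<in> hexagon L U 2 4 3 4 2 3"
      if "x \<in> below (A, B, C)" for x
      unfolding of_nat_less_iff[where 'a = int, symmetric] len
      by (rule refl_count_two_neg_even[OF below that]) (use even False w in \<open>auto simp: L_def U_def\<close>)
    show ?thesis
    proof (rule lookupI[where V = "hexagon L U 2 4 3 4 2 3"])
      fix x y assume "up x y" "y \<in> hexagon L U 2 4 3 4 2 3"
      then show "x \<in> hexagon L U 2 4 3 4 2 3" by (rule region_down_closed) simp_all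
    qed (use refl_count in blast)+
  next
    case odd
    have len: "int (alen (A, B, C)) = 2 * C + 1"
      using odd False w by simp
    have refl_count: "alen (A, B, C) < refl_count (A, B, C) x \<longleftrightarrow>
        x \<in> hexagon L U 3 5 4 5 3 4 \<and> C + 1 < U \<and> U < 2 * C"
      if "x \<in> below (A, B, C)" for x
      unfolding of_nat_less_iff[where 'a = int, symmetric] len
      by (rule refl_count_two_neg_odd[OF below that]) (use odd False w in \<open>auto simp: L_def U_def\<close>)
    show ?thesis
    proof (cases "C + 1 < U \<and> U < 2 * C")
      case True
      show ?thesis
      proof (rule lookupI[where V = "hexagon L U 3 5 4 5 3 4"])
        fix x y assume "up x y" "y \<in> hexagon L U 3 5 4 5 3 4"
        then show "x \<in> hexagon L U 3 5 4 5 3 4" by (rule region_down_closed) simp_all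
      qed (use refl_count True in blast)+
    next
      case False
      show ?thesis
        by (rule lookupI[where V = "{}"]) (use refl_count False in blast)+
    qed
  qed
qed

text \<open>Strip 0 lies below wall m if m >= 1 and above it if m <= 0, so the hypothesis puts x on
  the side of the fundamental alcove.\<close>

lemma up_reflect:
  assumes "x \<in> alcoves" "1 \<le> m \<and> coord i x \<le> m - 1 \<or> m \<le> 0 \<and> m \<le> coord i x"
  shows "up x (reflect i m x)"
proof -
  have "\<bar>coord i x\<bar> < \<bar>coord i (reflect i m x)\<bar>"
    using assms(2) by (cases x; cases i) auto
  then show ?thesis
    using alen_reflect_iff[OF assms(1)] unfolding up_def by blast
qed
lemma coords_mod:
  fixes p u v r g U :: int
  assumes "U = p + u + v + r"
  shows "(U - (g - v + u - (v - p))) mod 3 = (r - g) mod 3"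
proof -
  have "U - (g - v + u - (v - p)) = (r - g) + v * 3" using assms by linarith
  then show ?thesis by (simp only: mod_mult_self1)
qed

text \<open>For a spiral the intervals are triangles, and inside the relevant smaller triangle the
  excess only depends on residues modulo 3. An alcove with the wrong residue always has a
  reflection going up to an alcove with a good one.\<close>

lemma lookup_spiral_even:
  assumes k: "1 \<le> k"
  shows "lookup_property (- k, 0, k)"
proof -
  let ?w = "(- k, 0, k)" and ?V = "hexagon (- k) (2 * k) 2 2 1 2 0 1"
  have below: "below ?w = hexagon (- k) (2 * k) 0 1 0 2 0 1"
    using below_spiral(1)[OF k] by simp
  have len: "int (alen ?w) = 2 * k"
    using k by simp
  have L: "- k = 2 * k - 3 * k + 0" by simp
  have sub: "?V \<subseteq> below ?w"
    unfolding below by (auto simp: region_def)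
  have refl_count: "alen ?w < refl_count ?w (a, b, c) \<longleftrightarrow> (a, b, c) \<in> ?V \<and> (2 * k - (b - c)) mod 3 = 1"
    if "(a, b, c) \<in> below ?w" for a b c
    unfolding of_nat_less_iff[where 'a = int, symmetric] len by (rule refl_count_spiral_even[OF below that])
  have good: "alen ?w < refl_count ?w y"
    if y: "y = (p - u, g - v + u, v - p)" and "2 * k = p + u + v + r" "(r - g) mod 3 = 1" "y \<in> ?V" for y p u v r g
  proof -
    have "(p - u, g - v + u, v - p) \<in> ?V"
      using that(4) unfolding y .
    moreover from subsetD[OF sub this] have "(p - u, g - v + u, v - p) \<in> below ?w" .
    ultimately show ?thesis
      using that(3) unfolding y coords_mod[OF that(2), symmetric] by (simp only: refl_count simp_thms)
  qed
  show ?thesis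
  proof (rule lookupI[where V = ?V])
    fix x assume "x \<in> below ?w" "alen ?w < refl_count ?w x"
    then show "x \<in> ?V" using refl_count by (cases x) auto
  next
    fix x y assume "up x y" "y \<in> ?V"
    then show "x \<in> ?V" by (rule region_down_closed) simp_all
  next
    fix x assume V: "x \<in> ?V"
    then have alc: "x \<in> alcoves"
      by (auto simp: region_def)
    then obtain p u v r g where x: "x = (p - u, g - v + u, v - p)" and U: "2 * k = p + u + v + r"
      and r: "r = 0 \<or> r = 1 \<or> r = 2" and g: "g = 0 \<or> g = - 1"
      by (rule alcove_coords)
    note gaps = V[unfolded x hexagon_iff[OF U L g]]
    \<comment> \<open>Only the residue of r - g is to be corrected. Reflections of direction
      \<open>N2\<close> can keep r and exchange the two values of g, which does not help for r = 2;
      there direction \<open>N0\<close> is used.\<close>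
    consider (pos) "(r - g) mod 3 = 1" | (N2) "g = 0 \<and> r = 0 \<or> g = - 1 \<and> r = 1" | (N0) "r = 2"
      using r g by auto
    then show "alen ?w < refl_count ?w x \<or> (\<exists>z. up x z \<and> z \<in> below ?w \<and> alen ?w < refl_count ?w z)"
    proof cases
      case pos
      then show ?thesis using good[OF x U _ V] by simp
    next
      case N2
      \<comment> \<open>Among the walls numbered at most 0 that have x on the side of strip 0, this
        is the nearest to x, which keeps the image inside \<open>?V\<close>.\<close>
      define m where "m = min 0 (g - v + u)"
      have z: "reflect N2 m x = (p - (v + m), (- 1 - g) - (u - m) + (v + m), (u - m) - p)"
        unfolding x by simp
      have U': "2 * k = p + (v + m) + (u - m) + r" and g': "- 1 - g = 0 \<or> - 1 - g = - 1"
        using U g by auto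
      have m: "m = 0 \<and> 0 \<le> g - v + u \<or> m = g - v + u \<and> g - v + u < 0"
        unfolding m_def by auto
      have "reflect N2 m x \<in> ?V"
        unfolding z hexagon_iff[OF U' L g'] using gaps N2 m
        by (elim disjE conjE; hypsubst; simp add: gap_def)
      moreover have "(r - (- 1 - g)) mod 3 = 1"
        using N2 by auto
      ultimately have "alen ?w < refl_count ?w (reflect N2 m x)"
        using good[OF z U'] by simp
      moreover have "up x (reflect N2 m x)"
        by (rule up_reflect[OF alc]) (simp add: x m_def)
      ultimately show ?thesis
        using \<open>reflect N2 m x \<in> ?V\<close> sub by blast
    next
      case N0
      \<comment> \<open>This is the nearest suitable wall numbered at least 1. The remainder r = 2
        is carried into the new quotients, which leaves the new remainder 0 or 1.\<close>
      define m where "m = max 1 (v - p + 1)"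
      have "\<exists>p' u' v' r' g'. reflect N0 m x = (p' - u', g' - v' + u', v' - p') \<and>
          2 * k = p' + u' + v' + r' \<and> (r' - g') mod 3 = 1 \<and> reflect N0 m x \<in> ?V"
        using g
      proof
        assume g: "g = 0"
        have z: "reflect N0 m x = (v + 1 - m - (u + 1), - 1 - (p + m) + (u + 1), p + m - (v + 1 - m))"
          unfolding x using g by simp
        have U': "2 * k = (v + 1 - m) + (u + 1) + (p + m) + 0"
          using U N0 by simp
        have "reflect N0 m x \<in> ?V"
          unfolding z hexagon_iff[OF U' L disjI2[OF HOL.refl]] using gaps N0 g
          by (auto simp: gap_def m_def)
        then show ?thesis using z U' by fastforce
      next
        assume g: "g = - 1"
        have z: "reflect N0 m x = (v + 1 - m - u, 0 - (p + m) + u, p + m - (v + 1 - m))"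
          unfolding x using g by simp
        have U': "2 * k = (v + 1 - m) + u + (p + m) + 1"
          using U N0 by simp
        have "reflect N0 m x \<in> ?V"
          unfolding z hexagon_iff[OF U' L disjI1[OF HOL.refl]] using gaps N0 g
          by (auto simp: gap_def m_def)
        then show ?thesis using z U' by fastforce
      qed
      then obtain p' u' v' r' g' where z: "reflect N0 m x = (p' - u', g' - v' + u', v' - p')"
        and U': "2 * k = p' + u' + v' + r'" and "(r' - g') mod 3 = 1" and "reflect N0 m x \<in> ?V"
        by blast
      then have "alen ?w < refl_count ?w (reflect N0 m x)"
        using good[OF z U'] by simp
      moreover have "up x (reflect N0 m x)"
        by (rule up_reflect[OF alc]) (simp add: x m_def)
      ultimately show ?thesis
        using \<open>reflect N0 m x \<in> ?V\<close> sub by blast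
    qed
  qed
qed

text \<open>Now only the residue 1 is bad, and exchanging the values of g by a reflection of
  direction \<open>N2\<close> always leaves it.\<close>

lemma lookup_spiral_odd:
  assumes k: "1 \<le> k"
  shows "lookup_property (- k - 1, 0, k)"
proof -
  let ?w = "(- k - 1, 0, k)" and ?V = "hexagon (- k - 1) (2 * k + 1) 2 3 2 2 0 1"
  have below: "below ?w = hexagon (- k - 1) (2 * k + 1) 1 1 0 2 0 1"
    using below_spiral(2)[OF k] by simp
  have len: "int (alen ?w) = 2 * k + 1"
    using k by simp
  have L: "- k - 1 = 2 * k + 1 - 3 * (k + 1) + 1" by simp
  have sub: "?V \<subseteq> below ?w"
    unfolding below by (auto simp: region_def)
  have refl_count: "alen ?w < refl_count ?w (a, b, c) \<longleftrightarrow> (a, b, c) \<in> ?V \<and> (2 * k + 1 - (b - c)) mod 3 \<noteq> 1"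
    if "(a, b, c) \<in> below ?w" for a b c
    unfolding of_nat_less_iff[where 'a = int, symmetric] len by (rule refl_count_spiral_odd[OF below that])
  have good: "alen ?w < refl_count ?w y"
    if y: "y = (p - u, g - v + u, v - p)" and "2 * k + 1 = p + u + v + r" "(r - g) mod 3 \<noteq> 1" "y \<in> ?V" for y p u v r g
  proof -
    have "(p - u, g - v + u, v - p) \<in> ?V"
      using that(4) unfolding y .
    moreover from subsetD[OF sub this] have "(p - u, g - v + u, v - p) \<in> below ?w" .
    ultimately show ?thesis
      using that(3) unfolding y coords_mod[OF that(2), symmetric] by (simp only: refl_count simp_thms)
  qed
  show ?thesis
  proof (rule lookupI[where V = ?V])
    fix x assume "x \<in> below ?w" "alen ?w < refl_count ?w x"
    then show "x \<in> ?V" using refl_count by (cases x) auto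
  next
    fix x y assume "up x y" "y \<in> ?V"
    then show "x \<in> ?V" by (rule region_down_closed) simp_all
  next
    fix x assume V: "x \<in> ?V"
    then have alc: "x \<in> alcoves"
      by (auto simp: region_def)
    then obtain p u v r g where x: "x = (p - u, g - v + u, v - p)" and U: "2 * k + 1 = p + u + v + r"
      and r: "r = 0 \<or> r = 1 \<or> r = 2" and g: "g = 0 \<or> g = - 1"
      by (rule alcove_coords)
    note gaps = V[unfolded x hexagon_iff[OF U L g]]
    consider (pos) "(r - g) mod 3 \<noteq> 1" | (N2) "g = 0 \<and> r = 1 \<or> g = - 1 \<and> r = 0"
      using r g by auto
    then show "alen ?w < refl_count ?w x \<or> (\<exists>z. up x z \<and> z \<in> below ?w \<and> alen ?w < refl_count ?w z)"
    proof cases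
      case pos
      then show ?thesis using good[OF x U _ V] by simp
    next
      case N2
      define m where "m = min 0 (g - v + u)"
      have z: "reflect N2 m x = (p - (v + m), (- 1 - g) - (u - m) + (v + m), (u - m) - p)"
        unfolding x by simp
      have U': "2 * k + 1 = p + (v + m) + (u - m) + r" and g': "- 1 - g = 0 \<or> - 1 - g = - 1"
        using U g by auto
      have m: "m = 0 \<and> 0 \<le> g - v + u \<or> m = g - v + u \<and> g - v + u < 0"
        unfolding m_def by auto
      have "reflect N2 m x \<in> ?V"
        unfolding z hexagon_iff[OF U' L g'] using gaps N2 m U
        by (elim disjE conjE; hypsubst; simp add: gap_def)
      moreover have "(r - (- 1 - g)) mod 3 \<noteq> 1"
        using N2 by auto
      ultimately have "alen ?w < refl_count ?w (reflect N2 m x)"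
        using good[OF z U'] by simp
      moreover have "up x (reflect N2 m x)"
        by (rule up_reflect[OF alc]) (simp add: x m_def)
      ultimately show ?thesis
        using \<open>reflect N2 m x \<in> ?V\<close> sub by blast
    qed
  qed
qed

section \<open>Reduction to one sign pattern by symmetry\<close>

lemma lookup_rot: "lookup_property (b, c, a) \<Longrightarrow> lookup_property (a, b, c)"
  using symmetry_lookup[OF symmetry_rot, of "(b, c, a)"] symmetry_lookup[OF symmetry_rot, of "(c, a, b)"]
  by simp

lemma lookup_flip: "lookup_property (c, b, a) \<Longrightarrow> lookup_property (a, b, c)"
  using symmetry_lookup[OF symmetry_flip, of "(c, b, a)"] by simp

lemma lookup_origin: "lookup_property (0, 0, 0)"
proof -
  have "reflect i m (0, 0, 0) \<noteq> (0, 0, 0)" for i m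
    by (cases i) (simp_all, presburger+)
  then have "refl_count (0, 0, 0) (0, 0, 0) = 0"
    unfolding refl_count_def below_origin by simp
  then show ?thesis
    by (intro lookupI[where V = "{}"]) (simp_all add: below_origin)
qed

lemma lookup_simple: "lookup_property (- 1, 0, 0)"
proof -
  have below: "below (- 1, 0, 0) = region 0 0 (- 1) 0 1 0"
  proof (rule below_eqI[where i = N1])
    fix x y assume "up x y" "y \<in> region 0 0 (- 1) 0 1 0"
    then show "x \<in> region 0 0 (- 1) 0 1 0" by (rule region_down_closed) auto
  next
    fix x :: alcove assume "x \<in> region 0 0 (- 1) 0 1 0"
    then show "x \<in> below (reflect N1 0 (- 1, 0, 0)) \<or> reflect N1 0 x \<in> below (reflect N1 0 (- 1, 0, 0))"
      by (cases x) (simp add: below_origin region_def alcoves_def, presburger)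
  qed (auto simp: region_def alcoves_def)
  have "refl_count (- 1, 0, 0) y = 1" if "y \<in> below (- 1, 0, 0)" for y
  proof -
    have "y = (0, 0, 0) \<or> y = (- 1, 0, 0)"
      using that unfolding below by (cases y) (simp add: region_def alcoves_def, presburger)
    then show ?thesis
      using refl_count_region[OF below, of 0 0 0] refl_count_region[OF below, of "- 1" 0 0] that
      by (elim disjE) simp_all
  qed
  then show ?thesis
    by (intro lookupI[where V = "{}"]) auto
qed

lemma lookup_neg_pos:
  assumes "(A, B, C) \<in> alcoves" "A < 0" "0 < C"
  shows "lookup_property (A, B, C)"
proof (cases "B = 0")
  case True
  then have "A = - C \<or> A = - C - 1"
    using assms(1) by (auto simp: alcoves_def)
  then show ?thesis
    using True lookup_spiral_even[of C] lookup_spiral_odd[of C] assms(3) by auto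
qed (rule lookup_hexagon[OF assms])

lemma lookup_alcove:
  assumes "w \<in> alcoves"
  shows "lookup_property w"
proof -
  obtain a b c where w: "w = (a, b, c)" by (cases w)
  have s: "a + b + c = 0 \<or> a + b + c = - 1"
    using assms by (simp add: w alcoves_def)
  have np: "lookup_property (A, B, C)" if "A + B + C = a + b + c" "A < 0" "0 < C" for A B C
    using lookup_neg_pos that s by (simp add: alcoves_def)
  \<comment> \<open>Coordinates with sum 0 or -1 take both signs, except at the fundamental alcove
    and its three neighbours. Rotations and the flip carry the six sign patterns to A < 0 <
    C.\<close>
  consider "a = 0 \<and> b = 0 \<and> c = 0" | "a = - 1 \<and> b = 0 \<and> c = 0" | "a = 0 \<and> b = - 1 \<and> c = 0"
    | "a = 0 \<and> b = 0 \<and> c = - 1" | "a < 0 \<and> 0 < c" | "b < 0 \<and> 0 < a" | "c < 0 \<and> 0 < b"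
    | "c < 0 \<and> 0 < a" | "a < 0 \<and> 0 < b" | "b < 0 \<and> 0 < c"
    using s by (smt (verit))
  then show ?thesis
    unfolding w
  proof cases
    case 1 then show "lookup_property (a, b, c)" using lookup_origin by simp
  next
    case 2 then show "lookup_property (a, b, c)" using lookup_simple by simp
  next
    case 3 then show "lookup_property (a, b, c)" using lookup_rot[OF lookup_simple] lookup_rot by simp
  next
    case 4 then show "lookup_property (a, b, c)" using lookup_rot[OF lookup_rot[OF lookup_simple]] lookup_rot[OF lookup_simple] by simp
  next
    case 5 then show "lookup_property (a, b, c)" by (intro np) simp_all
  next
    case 6 then show "lookup_property (a, b, c)" by (intro lookup_rot[of b c a] np) simp_all
  next
    case 7 then show "lookup_property (a, b, c)" by (intro lookup_rot[of b c a] lookup_rot[of c a b] np) simp_all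
  next
    case 8 then show "lookup_property (a, b, c)" by (intro lookup_flip[of c b a] np) simp_all
  next
    case 9 then show "lookup_property (a, b, c)"
      by (intro lookup_flip[of c b a] lookup_rot[of b a c] lookup_rot[of a c b] np) simp_all
  next
    case 10 then show "lookup_property (a, b, c)"
      by (intro lookup_flip[of c b a] lookup_rot[of b a c] np) simp_all
  qed
qed

section \<open>The Coxeter group as a group of alcoves\<close>

abbreviation simple :: "node \<Rightarrow> affine_A2" where
  "simple \<equiv> simple_reflection"

lemma simple_simple [simp]: "simple i * simple i = 1" "simple i * (simple i * x) = x"
proof -
  show *: "simple i * simple i = 1"
    unfolding simple_reflection_def one_affine_A2_def times_affine_A2_def
    by (metis append_Cons append_Nil coxeter_eq.involution one_affine_A2.abs_eq one_affine_A2_def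
        affine_A2.abs_eq_iff times_affine_A2.abs_eq times_affine_A2_def)
  show "simple i * (simple i * x) = x"
    by (simp add: * flip: mult.assoc)
qed

lemma simple_braid:
  assumes "i \<noteq> j"
  shows "simple i * (simple j * (simple i * x)) = simple j * (simple i * (simple j * x))"
proof -
  have "word [i, j, i, j, i, j] = 1"
    using coxeter_eq.order3[OF assms] by (simp add: affine_A2.abs_eq_iff one_affine_A2_def)
  then have "simple i * (simple j * (simple i * (simple j * (simple i * simple j)))) = 1"
    by (simp add: simple_reflection_def times_affine_A2.abs_eq)
  then have "simple i * (simple j * (simple i * (simple j * (simple i * simple j)))) *
      (simple j * (simple i * (simple j * x))) = simple j * (simple i * (simple j * x))"
    by simp
  then show ?thesis by (simp add: mult.assoc)
qed

lemma affine_A2_induct [case_names one simple]: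
  assumes "P 1" "\<And>i x. P x \<Longrightarrow> P (simple i * x)"
  shows "P x"
proof -
  have "P (word u)" for u
  proof (induction u)
    case Nil
    then show ?case using assms(1) by (simp add: one_affine_A2_def)
  next
    case (Cons i u)
    from assms(2)[OF this, of i] show ?case
      by (simp add: simple_reflection_def times_affine_A2.abs_eq)
  qed
  then show ?thesis by (metis Quotient_abs_rep[OF Quotient_affine_A2])
qed

lemma inverse_simple: "inverse (simple i) = simple i"
  by (metis affine_A2_left_inverse mult.assoc mult.right_neutral mult_1 simple_simple(1))

lemma inverse_mult: "inverse (x * y) = inverse y * inverse x" for x y :: affine_A2
  by (metis affine_A2_left_inverse affine_A2_right_inverse mult.assoc mult.right_neutral mult_1)

lemma foldr_coxeter_eq:
  "coxeter_eq u v \<Longrightarrow> foldr (\<lambda>i. reflect i 0) u x = foldr (\<lambda>i. reflect i 0) v x"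
proof (induction arbitrary: x rule: coxeter_eq.induct)
  case (order3 i j)
  then show ?case by (cases x; cases i; cases j) simp_all
qed simp_all

lift_definition act :: "affine_A2 \<Rightarrow> alcove \<Rightarrow> alcove" is "foldr (\<lambda>i. reflect i 0)"
  using foldr_coxeter_eq by blast

lemma act_one [simp]: "act 1 x = x"
  by transfer simp

lemma act_mult [simp]: "act (v * w) x = act v (act w x)"
  by transfer simp

lemma act_simple [simp]: "act (simple i) x = reflect i 0 x"
  unfolding simple_reflection_def by (simp add: act.abs_eq)

definition alcove_of :: "affine_A2 \<Rightarrow> alcove" where
  "alcove_of w = act w (0, 0, 0)"

lemma alcove_of_simple: "alcove_of (simple i * w) = reflect i 0 (alcove_of w)"
  by (simp add: alcove_of_def)

lemma alcove_of_in_alcoves [simp]: "alcove_of w \<in> alcoves"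
proof (induction w rule: affine_A2_induct)
  case one
  then show ?case by (simp add: alcove_of_def alcoves_def)
qed (simp add: alcove_of_simple)

lemma alen_descent: "coord i t < 0 \<Longrightarrow> alen (reflect i 0 t) < alen t"
  by (cases t; cases i) (auto simp: alen_less_iff simp del: alen.simps)

text \<open>The descents of an alcove are its negative coordinates, so reflecting in any of them leads
  back to the fundamental alcove; by the braid relations, the group element that is read off does
  not depend on the choices. This makes the action on alcoves simply transitive.\<close>

function element_of :: "alcove \<Rightarrow> affine_A2" where
  "element_of t =
    (if coord N1 t < 0 then simple N1 * element_of (reflect N1 0 t)
     else if coord N2 t < 0 then simple N2 * element_of (reflect N2 0 t)
     else if coord N0 t < 0 then simple N0 * element_of (reflect N0 0 t)
     else 1)"
  by auto
termination
  by (relation "Wellfounded.measure alen") (use alen_descent in auto)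

declare element_of.simps [simp del]

lemma coord_braid:
  assumes "t \<in> alcoves" "i \<noteq> j" "coord i t < 0" "coord j t < 0"
  shows "coord j (reflect i 0 t) < 0" "coord i (reflect j 0 (reflect i 0 t)) < 0"
    "reflect i 0 (reflect j 0 (reflect i 0 t)) = reflect j 0 (reflect i 0 (reflect j 0 t))"
  using assms by (cases t; cases i; cases j; auto simp: alcoves_def)+

lemma element_of_descent:
  assumes "t \<in> alcoves" "coord i t < 0"
  shows "element_of t = simple i * element_of (reflect i 0 t)"
  using assms
proof (induction "alen t" arbitrary: t i rule: less_induct)
  case less
  have "\<exists>j. coord j t < 0 \<and> element_of t = simple j * element_of (reflect j 0 t)"
    using less.prems by (cases i) (auto simp: element_of.simps[of t])
  then obtain j where j: "coord j t < 0" "element_of t = simple j * element_of (reflect j 0 t)"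
    by blast
  show ?case
  proof (cases "i = j")
    case False
    \<comment> \<open>Two descents i' and j' allow i', j', i' to be removed in turn, the last two by
      the induction hypothesis. Exchanging their roles reaches the same alcove, so the braid
      relation identifies the two results.\<close>
    have step: "element_of (reflect i' 0 t) =
        simple j' * (simple i' * element_of (reflect i' 0 (reflect j' 0 (reflect i' 0 t))))"
      if "i' \<noteq> j'" "coord i' t < 0" "coord j' t < 0" for i' j'
    proof -
      note c = coord_braid[OF less.prems(1) that]
      have "element_of (reflect i' 0 t) = simple j' * element_of (reflect j' 0 (reflect i' 0 t))"
        using less.hyps[OF alen_descent[OF that(2)]] less.prems(1) c(1) by simp
      moreover have "element_of (reflect j' 0 (reflect i' 0 t)) =
          simple i' * element_of (reflect i' 0 (reflect j' 0 (reflect i' 0 t)))"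
        using less.hyps[OF less_trans[OF alen_descent[OF c(1)] alen_descent[OF that(2)]]]
          less.prems(1) c(2) by simp
      ultimately show ?thesis by simp
    qed
    show ?thesis
      using j(2) step[of i j] step[of j i] False less.prems(2) j(1)
        coord_braid(3)[OF less.prems(1) False] simple_braid[OF False] by simp
  qed (use j in simp)
qed

lemma element_of_reflect:
  assumes "t \<in> alcoves"
  shows "element_of (reflect i 0 t) = simple i * element_of t"
proof (cases "coord i t < 0")
  case True
  then show ?thesis using element_of_descent[OF assms] by simp
next
  case False
  then have "coord i (reflect i 0 t) < 0"
    by (cases t; cases i) auto
  then show ?thesis
    using element_of_descent[of "reflect i 0 t" i] assms by simp
qed

lemma element_of_alcove_of [simp]: "element_of (alcove_of w) = w"
proof (induction w rule: affine_A2_induct)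
  case one
  then show ?case by (simp add: alcove_of_def element_of.simps)
next
  case (simple i w)
  then show ?case by (simp add: alcove_of_simple element_of_reflect)
qed

lemma alcove_of_inject: "alcove_of v = alcove_of w \<longleftrightarrow> v = w"
  by (metis element_of_alcove_of)

lemma alcove_of_element_of:
  assumes "t \<in> alcoves"
  shows "alcove_of (element_of t) = t"
  using assms
proof (induction "alen t" arbitrary: t rule: less_induct)
  case less
  show ?case
  proof (cases "\<exists>i. coord i t < 0")
    case True
    then obtain i where i: "coord i t < 0" by blast
    have "alcove_of (element_of (reflect i 0 t)) = reflect i 0 t"
      using less.hyps[OF alen_descent[OF i]] less.prems by simp
    then show ?thesis
      using element_of_descent[OF less.prems i] by (simp add: alcove_of_simple)
  next
    case False
    obtain a b c where t: "t = (a, b, c)" by (cases t)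
    have "0 \<le> a" "0 \<le> b" "0 \<le> c"
      using False[unfolded not_ex not_less, rule_format, of N1]
        False[unfolded not_ex not_less, rule_format, of N2]
        False[unfolded not_ex not_less, rule_format, of N0] by (simp_all add: t)
    with less.prems have "t = (0, 0, 0)"
      by (auto simp: t alcoves_def)
    then show ?thesis by (simp add: element_of.simps alcove_of_def)
  qed
qed

lemma alen_reflect_le: "alen (reflect i 0 t) \<le> Suc (alen t)"
  by (cases t; cases i) (simp_all add: nat_le_iff)

lemma exists_word_alen: "t \<in> alcoves \<Longrightarrow> \<exists>u. length u = alen t \<and> word u = element_of t"
proof (induction "alen t" arbitrary: t rule: less_induct)
  case less
  show ?case
  proof (cases "\<exists>i. coord i t < 0")
    case True
    then obtain i where i: "coord i t < 0" by blast
    obtain u where u: "length u = alen (reflect i 0 t)" "word u = element_of (reflect i 0 t)"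
      using less.hyps[OF alen_descent[OF i]] less.prems by auto
    have "Suc (alen (reflect i 0 t)) = alen t"
      using alen_descent[OF i] alen_reflect_le[of i "reflect i 0 t"] by simp
    moreover have "word (i # u) = element_of t"
      using u(2) element_of_descent[OF less.prems i]
      by (simp add: simple_reflection_def times_affine_A2.abs_eq flip: u(2))
    ultimately show ?thesis using u(1) by (intro exI[of _ "i # u"]) simp
  next
    case False
    then have "element_of t = 1"
      by (simp add: element_of.simps)
    moreover from this have "t = (0, 0, 0)"
      using alcove_of_element_of[OF less.prems] by (simp add: alcove_of_def)
    ultimately show ?thesis
      by (intro exI[of _ "[]"]) (simp add: one_affine_A2_def)
  qed
qed

lemma alen_alcove_of_word: "alen (alcove_of (word u)) \<le> length u"
proof (induction u)
  case Nil
  then show ?case by (simp add: alcove_of_def act.abs_eq)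
next
  case (Cons i u)
  have "word (i # u) = simple i * word u"
    by (simp add: simple_reflection_def times_affine_A2.abs_eq)
  then show ?case
    using Cons alen_reflect_le[of i "alcove_of (word u)"] by (simp add: alcove_of_simple)
qed

text \<open>Removing descents gives a word of length \<open>alen\<close>, and no word is shorter
  because each letter adds at most one wall.\<close>

lemma len_eq_alen: "len w = alen (alcove_of w)"
  unfolding len_def
proof (rule Least_equality)
  show "\<exists>u. length u = alen (alcove_of w) \<and> word u = w"
    using exists_word_alen[of "alcove_of w"] by simp
qed (use alen_alcove_of_word in blast)

text \<open>Conjugation by simple reflections changes the wall number m to - m in the same direction
  and to 1 - m in another one. From m = 0, their composite m + 1 reaches all naturals, and negation
  the remaining integers.\<close>

lemma reflection_of_wall:
  "\<exists>r\<in>reflections. \<forall>x. act r x = reflect i m x"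
proof -
  define P where "P m \<longleftrightarrow> (\<forall>i. \<exists>r\<in>reflections. \<forall>x. act r x = reflect i m x)" for m
  have conj: "simple j * r * simple j \<in> reflections" if "r \<in> reflections" for r j
  proof -
    obtain x i where "r = x * simple i * inverse x"
      using \<open>r \<in> reflections\<close> by (auto simp: reflections_def)
    then have "simple j * r * simple j = (simple j * x) * simple i * inverse (simple j * x)"
      by (simp add: inverse_mult inverse_simple mult.assoc)
    then show ?thesis by (auto simp: reflections_def)
  qed
  have "simple i \<in> reflections" for i
  proof -
    have "inverse (1 :: affine_A2) = 1"
      using affine_A2_left_inverse[of 1] by simp
    then have "simple i = 1 * simple i * inverse 1" by simp
    then show ?thesis unfolding reflections_def by blast
  qed
  then have P0: "P 0"
    unfolding P_def using act_simple by blast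
  have neg: "P (- m)" if Pm: "P m" for m
    unfolding P_def
  proof
    fix i
    obtain r where r: "r \<in> reflections" "\<And>x. act r x = reflect i m x"
      using Pm unfolding P_def by blast
    have "act (simple i * r * simple i) x = reflect i (- m) x" for x
      by (cases x; cases i) (simp_all add: r(2))
    then show "\<exists>r\<in>reflections. \<forall>x. act r x = reflect i (- m) x"
      using conj[OF r(1)] by blast
  qed
  have flip: "P (1 - m)" if Pm: "P m" for m
    unfolding P_def
  proof
    fix i
    define j k where "j = (case i of N0 \<Rightarrow> N1 | N1 \<Rightarrow> N2 | N2 \<Rightarrow> N0)"
      and "k = (case i of N0 \<Rightarrow> N2 | N1 \<Rightarrow> N0 | N2 \<Rightarrow> N1)"
    obtain r where r: "r \<in> reflections" "\<And>x. act r x = reflect j m x"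
      using Pm unfolding P_def by blast
    have "act (simple k * r * simple k) x = reflect i (1 - m) x" for x
      by (cases x; cases i) (simp_all add: r(2) j_def k_def)
    then show "\<exists>r\<in>reflections. \<forall>x. act r x = reflect i (1 - m) x"
      using conj[OF r(1)] by blast
  qed
  have nat: "P (int n)" for n
  proof (induction n)
    case (Suc n)
    from flip[OF neg[OF this]] show ?case by (simp add: add.commute)
  qed (simp add: P0)
  have "P m"
  proof (cases "0 \<le> m")
    case True
    then show ?thesis using nat[of "nat m"] by simp
  next
    case False
    then show ?thesis using neg[OF nat[of "nat (- m)"]] by simp
  qed
  then show ?thesis unfolding P_def by blast
qed

text \<open>Induction on the conjugating element: simple reflections permute the walls, by the same
  rule as in \<open>up_simple\<close>.\<close>

lemma reflection_is_wall:
  assumes "r \<in> reflections"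
  shows "\<exists>i m. alcove_of (r * x) = reflect i m (alcove_of x)"
proof -
  obtain v j where r: "r = v * simple j * inverse v"
    using assms by (auto simp: reflections_def)
  have "\<exists>i m. act (v * simple j * inverse v) t = reflect i m t" for t
  proof (induction v arbitrary: t rule: affine_A2_induct)
    case one
    have "inverse (1 :: affine_A2) = 1"
      using affine_A2_left_inverse[of 1] by simp
    then show ?case by auto
  next
    case (simple k v)
    obtain i m where im: "act (v * simple j * inverse v) (reflect k 0 t) = reflect i m (reflect k 0 t)"
      using simple by blast
    have "act (simple k * v * simple j * inverse (simple k * v)) t =
        reflect k 0 (act (v * simple j * inverse v) (reflect k 0 t))"
      by (simp add: inverse_mult inverse_simple)
    also have "\<dots> = reflect k 0 (reflect i m (reflect k 0 t))"
      by (simp only: im)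
    also have "\<exists>i' m'. \<dots> = reflect i' m' t"
    proof -
      define i' where "i' = (if i = k then i else if i \<noteq> N0 \<and> k \<noteq> N0 then N0
        else if i \<noteq> N1 \<and> k \<noteq> N1 then N1 else N2)"
      have "reflect k 0 (reflect i m (reflect k 0 t)) = reflect i' (if i = k then - m else 1 - m) t"
        unfolding i'_def by (cases t; cases i; cases k) simp_all
      then show ?thesis by blast
    qed
    finally show ?case .
  qed
  then show ?thesis
    by (simp add: r alcove_of_def)
qed

lemma reflect_inject:
  assumes "x \<in> alcoves" "reflect i m x = reflect j n x"
  shows "i = j \<and> m = n"
  using assms by (cases x; cases i; cases j) (auto simp: alcoves_def, presburger+)

lemma bruhat_step_iff_up: "bruhat_step x y \<longleftrightarrow> up (alcove_of x) (alcove_of y)"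
proof
  assume "bruhat_step x y"
  then show "up (alcove_of x) (alcove_of y)"
    using reflection_is_wall unfolding bruhat_step_def up_def len_eq_alen by metis
next
  assume "up (alcove_of x) (alcove_of y)"
  then obtain i m where y: "alcove_of y = reflect i m (alcove_of x)"
    and len: "len x < len y"
    by (auto simp: up_def len_eq_alen)
  obtain r where r: "r \<in> reflections" "\<And>t. act r t = reflect i m t"
    using reflection_of_wall by blast
  have "alcove_of y = alcove_of (r * x)"
    using r(2) y by (simp add: alcove_of_def)
  then show "bruhat_step x y"
    using r(1) len by (auto simp: bruhat_step_def alcove_of_inject)
qed

lemma le_iff_below: "x \<le> w \<longleftrightarrow> alcove_of x \<in> below (alcove_of w)"
proof -
  have "up\<^sup>*\<^sup>* (alcove_of x) (alcove_of w)" if "bruhat_step\<^sup>*\<^sup>* x w"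
    using that
    by (induction rule: rtranclp_induct) (auto simp: bruhat_step_iff_up intro: rtranclp.rtrancl_into_rtrancl)
  moreover have "bruhat_step\<^sup>*\<^sup>* x (element_of t)" if "up\<^sup>*\<^sup>* (alcove_of x) t" for t
    using that
  proof (induction rule: rtranclp_induct)
    case (step s t)
    have "s \<in> alcoves" "t \<in> alcoves"
      using rtranclp_up_in_alcoves[OF step.hyps(1)] up_in_alcoves[OF step.hyps(2)] by auto
    then have "bruhat_step (element_of s) (element_of t)"
      using step.hyps(2) by (simp add: bruhat_step_iff_up alcove_of_element_of)
    with step.IH show ?case by (rule rtranclp.rtrancl_into_rtrancl)
  qed simp
  from this[of "alcove_of w"] have "bruhat_step\<^sup>*\<^sup>* x w" if "up\<^sup>*\<^sup>* (alcove_of x) (alcove_of w)"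
    using that by simp
  ultimately show ?thesis
    by (auto simp: less_eq_affine_A2_def below_def)
qed

text \<open>Pairs (i, m) correspond bijectively to reflections: the image of the fundamental alcove
  determines the wall, and cancelling x on the right recovers r from r * x.\<close>

lemma bruhat_n_eq_refl_count: "bruhat_n w x = refl_count (alcove_of w) (alcove_of x)"
proof -
  obtain wall where wall: "\<And>i m. wall (i, m) \<in> reflections" "\<And>i m t. act (wall (i, m)) t = reflect i m t"
  proof -
    have "\<forall>p. \<exists>r. r \<in> reflections \<and> (\<forall>t. act r t = reflect (fst p) (snd p) t)"
      using reflection_of_wall by blast
    from choice[OF this] obtain f where "\<forall>p. f p \<in> reflections \<and> (\<forall>t. act (f p) t = reflect (fst p) (snd p) t)" ..
    then show ?thesis by (intro that[of f]) (simp_all del: split_paired_All)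
  qed
  have mult: "alcove_of (wall (i, m) * x) = reflect i m (alcove_of x)" for i m x
    by (simp add: alcove_of_def wall(2))
  have "{r \<in> reflections. r * x \<le> w} =
      wall ` {(i, m). reflect i m (alcove_of x) \<in> below (alcove_of w)}"
  proof (intro equalityI subsetI)
    fix r assume r: "r \<in> {r \<in> reflections. r * x \<le> w}"
    then obtain i m where im: "alcove_of (r * x) = reflect i m (alcove_of x)"
      using reflection_is_wall by blast
    then have "r * x = wall (i, m) * x"
      by (simp add: mult flip: alcove_of_inject)
    then have "r * x * inverse x = wall (i, m) * x * inverse x"
      by simp
    then have "r = wall (i, m)"
      by (simp add: mult.assoc affine_A2_right_inverse)
    then show "r \<in> wall ` {(i, m). reflect i m (alcove_of x) \<in> below (alcove_of w)}"
      using r im by (intro image_eqI[of _ _ "(i, m)"]) (auto simp: le_iff_below)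
  qed (auto simp: le_iff_below mult wall(1))
  moreover have "inj wall"
  proof (rule injI)
    fix p q assume "wall p = wall q"
    then have "reflect (fst p) (snd p) (0, 0, 0) = reflect (fst q) (snd q) (0, 0, 0)"
      using wall(2)[of "fst p" "snd p" "(0, 0, 0)"] wall(2)[of "fst q" "snd q" "(0, 0, 0)"] by simp
    then have "fst p = fst q \<and> snd p = snd q"
      by (rule reflect_inject[rotated]) (simp add: alcoves_def)
    then show "p = q" by (simp add: prod_eq_iff)
  qed
  ultimately show ?thesis
    unfolding bruhat_n_def refl_count_def by (simp add: card_image inj_on_subset)
qed

lemma bruhat_q_pos_iff:
  "0 < bruhat_q w x \<longleftrightarrow> alen (alcove_of w) < refl_count (alcove_of w) (alcove_of x)"
  by (simp add: bruhat_q_def bruhat_n_eq_refl_count len_eq_alen)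

section \<open>From alcoves back to Schubert varieties\<close>

theorem corollary8p4:
  fixes w x :: affine_A2
  assumes Carrell_Peterson:
    "\<And>v u :: affine_A2. u \<le> v \<Longrightarrow>
       (\<not> rationally_smooth (schubert_variety v) (len v) (torus_fixed_point u)) \<longleftrightarrow>
       (\<exists>y. u \<le> y \<and> y \<le> v \<and> bruhat_q v y > 0)"
    and "x \<le> w"
  shows "(\<not> rationally_smooth (schubert_variety w) (len w) (torus_fixed_point x)) \<longleftrightarrow>
    (bruhat_q w x > 0 \<or>
     (\<exists>r\<in>reflections. x < r * x \<and> r * x \<le> w \<and> bruhat_q w (r * x) > 0))"
  unfolding Carrell_Peterson[OF \<open>x \<le> w\<close>]
proof
  assume "\<exists>y. x \<le> y \<and> y \<le> w \<and> bruhat_q w y > 0"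
  then obtain y where "x \<le> y" "y \<le> w" "bruhat_q w y > 0" by blast
  then have "bruhat_q w x > 0 \<or> (\<exists>z. up (alcove_of x) z \<and> z \<in> below (alcove_of w) \<and>
      alen (alcove_of w) < refl_count (alcove_of w) z)"
    using lookup_alcove[OF alcove_of_in_alcoves[of w]]
    unfolding lookup_property_def le_iff_below bruhat_q_pos_iff by blast
  then show "bruhat_q w x > 0 \<or>
     (\<exists>r\<in>reflections. x < r * x \<and> r * x \<le> w \<and> bruhat_q w (r * x) > 0)"
  proof
    assume "\<exists>z. up (alcove_of x) z \<and> z \<in> below (alcove_of w) \<and>
      alen (alcove_of w) < refl_count (alcove_of w) z"
    then obtain z where z: "up (alcove_of x) z" "z \<in> below (alcove_of w)"
      "alen (alcove_of w) < refl_count (alcove_of w) z"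
      by blast
    have "z = alcove_of (element_of z)"
      using up_in_alcoves[OF z(1)] by (simp add: alcove_of_element_of)
    then have "bruhat_step x (element_of z)" "element_of z \<le> w" "bruhat_q w (element_of z) > 0"
      using z by (simp_all add: bruhat_step_iff_up le_iff_below bruhat_q_pos_iff)
    \<comment> \<open>A step upwards is a length-increasing left multiplication by a reflection,
      which is the required r.\<close>
    moreover from this(1) obtain r where "r \<in> reflections" "element_of z = r * x" "len x < len (r * x)"
      by (auto simp: bruhat_step_def)
    moreover from \<open>bruhat_step x (element_of z)\<close> have "x \<le> element_of z"
      by (simp add: less_eq_affine_A2_def)
    ultimately show ?thesis
      by (auto simp: less_affine_A2_def intro!: disjI2 bexI[of _ r])
  qed simp
\<comment> \<open>Conversely, x or r * x serves as y.\<close>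
qed (use \<open>x \<le> w\<close> in \<open>auto simp: less_affine_A2_def\<close>)

end
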